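(* Let $\mathcal{T}$ be the coupling space of a Hessian quantum field theory, with global affine coordinates $t=(t^1,\dots,t^n)$, and let $F(t,u)=F_0(t)+uF_1(t)+u^2F_2(t)+\cdots$ be its free energy, a formal power series in $u$ with coefficients in $C^\infty(\mathcal{T})$. Assume that for each fixed $u$ (in the formal sense) $F(\cdot,u)$ is strictly convex and the Hessian metric $g_{ij}(t,u)=\partial_i\partial_jF(t,u)$ is positive definite. Let $D=\operatorname{Spec} k[[u]]$ and let $\pi_{\mathcal{T}}:\mathcal{T}\times D\to\mathcal{T}$ be the projection. Then $\mathcal{T}$ carries a natural family of Legendre bundles over $\mathcal{T}\times D$, given by the quintuple $(H,\langle\!\langle\cdot,\cdot\rangle\!\rangle,\nabla^+,\nabla^-,\Psi)$, where: (i) $H=H^+\oplus H^-$ with $H^+=\pi_{\mathcal{T}}^*T\mathcal{T}$ and $H^-=\pi_{\mathcal{T}}^*T^*\mathcal{T}$; (ii) $\langle\!\langle\cdot,\cdot\rangle\!\rangle$ is the canonical evaluation between tangent and cotangent vectors, extended symmetrically so as to vanish on $H^+\otimes H^+$ and on $H^-\otimes H^-$; (iii) $\nabla^+$ and $\nabla^-$ are the flat connections on $H^+$ and $H^-$ induced by the affine coordinates on $\mathcal{T}$ and on the dual space $\mathcal{T}^*$, respectively; (iv) $\Psi(t,u)=F(t,u)$.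
   Context: Conventions. $k$ is $\mathbb{R}$ or $\mathbb{C}$, and $D=\operatorname{Spec} k[[u]]$ is the formal disk with coordinate $u$. For a smooth manifold $B$, objects over $B\times D$ are smooth along $B$ and formal in $u$: functions on $B\times D$ are formal power series in $u$ whose coefficients are smooth functions on $B$ (tensored with $k$ if $k=\mathbb{C}$), bundles, pairings and connections are defined over this ring, and vector fields on $B\times D$ are spanned over it by vector fields on $B$ and $\partial_u$. $C^\infty(B)$ denotes real-valued smooth functions. Statements "for each fixed $u$ (in the formal sense)" mean: treat $u$ as a constant parameter and require the identities as identities of formal power series in $u$. For a formal series $\Psi=\psi+u\psi_1+\cdots$, "strictly convex" and "positive-definite Hessian" in the formal sense mean that the Hessian of the constant term $\psi$ is positive definite; $\psi_1,\psi_2,\dots$ are arbitrary. Hessian QFT. A Hessian quantum field theory is a quantum field theory such that: (1) its coupling space $\mathcal{T}$ is an open convex subset of $\mathbb{R}^n$ (or more generally a smooth manifold with global affine coordinates); (2) its free energy $F(t,u)=F_0(t)+uF_1(t)+u^2F_2(t)+\cdots$ is a formal power series in $u$ with coefficients in $C^\infty(\mathcal{T})$, strictly convex for each fixed $u$ in the formal sense; (3) the Hessian $g_{ij}(t,u)=\partial_i\partial_jF(t,u)$ in the affine coordinates defines a positive-definite metric which, together with the affine structure on $\mathcal{T}$ and its dual, makes $\mathcal{T}$ a dually flat (Hessian) manifold for each fixed $u$. Only the data $(\mathcal{T},F)$ are used. (Dually flat: a Riemannian metric $g$ with two torsion-free flat connections $\nabla^{\pm}$ on the tangent bundle satisfying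 $Z\,g(X,Y)=g(\nabla^+_ZX,Y)+g(X,\nabla^-_ZY)$, with local potentials $\Psi,\Psi^*$ related by $\Psi(\theta)+\Psi^*(\eta)=\langle\theta,\eta\rangle$ for $\eta=d\Psi(\theta)$.) Induced connections. $\nabla^+$ is the connection on $H^+$ for which the coordinate frame $\partial_i=\partial/\partial t^i$ is parallel. The dual affine coordinates are $\eta_i=\partial_iF(t,u)$; $\nabla^-$ is the connection on $H^-$ for which the coframe $g(\partial/\partial\eta_i,\cdot)$ (which equals $dt^i$) is parallel, i.e. the connection on tangent vectors with $\partial/\partial\eta_i$ parallel, transported to cotangent vectors by $g$. Parallelism is along all directions of $\mathcal{T}\times D$, including $\partial_u$. Classical Legendre bundle. Over a smooth manifold $B$, it is a quintuple $(H,\langle\!\langle\cdot,\cdot\rangle\!\rangle,\nabla^+,\nabla^-,\Psi)$ where: (1) $H=H^+\oplus H^-$ is a vector bundle with isomorphisms $H^+\cong TB$, $H^-\cong T^*B$; (2) $\langle\!\langle\cdot,\cdot\rangle\!\rangle$ is a non-degenerate symmetric bilinear form on $H$ vanishing on $H^+\otimes H^+$ and on $H^-\otimes H^-$, with $\langle\!\langle X,\alpha\rangle\!\rangle=\alpha(X)$ for $X\in H^+$, $\alpha\in H^-$; (3) $\nabla^{\pm}$ are flat connections on $H^{\pm}$ with $Z\langle\!\langle X,\alpha\rangle\!\rangle=\langle\!\langle\nabla^+_ZX,\alpha\rangle\!\rangle+\langle\!\langle X,\nabla^-_Z\alpha\rangle\!\rangle$ for all sections $X$ of $H^+$, $\alpha$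 of $H^-$ and vector fields $Z$; here $\nabla^+$, viewed on $TB$, is torsion-free, so that local $\nabla^+$-flat coordinates $(\theta^i)$ (with $\partial_i$ parallel) exist; (4) $\Psi\in C^\infty(B)$ is strictly convex with respect to the flat structure of $\nabla^+$ (positive-definite Hessian in $\nabla^+$-flat coordinates), with associated Legendre morphism $\mathscr{L}_\Psi:H^+\to H^-$, $\mathscr{L}_\Psi(\partial_j)=\sum_i(\partial_i\partial_j\Psi)\,d\theta^i$. Family of Legendre bundles. Over $B\times D$, with projection $\pi_B$ to $B$, it is a quintuple $(H,\langle\!\langle\cdot,\cdot\rangle\!\rangle,\nabla^+,\nabla^-,\Psi)$ where: $H=H^+\oplus H^-$ is a vector bundle over $B\times D$ with isomorphisms $H^+\cong\pi_B^*TB$, $H^-\cong\pi_B^*T^*B$ independent of $u$; $\langle\!\langle\cdot,\cdot\rangle\!\rangle$ is a non-degenerate symmetric bilinear form on $H$ vanishing on $H^+\otimes H^+$ and $H^-\otimes H^-$ and inducing the canonical evaluation on $H^+\otimes H^-$; $\nabla^{\pm}$ are flat connections on $H^{\pm}$ satisfying the duality condition $Z\langle\!\langle X,\alpha\rangle\!\rangle=\langle\!\langle\nabla^+_ZX,\alpha\rangle\!\rangle+\langle\!\langle X,\nabla^-_Z\alpha\rangle\!\rangle$ for all sections $X$ of $H^+$, $\alpha$ of $H^-$ and all vector fields $Z$ on $B\times D$ (in particular $\partial_u$); $\Psi=\psi+u\psi_1+u^2\psi_2+\cdots$ is a formal power series in $u$ with coefficients in $C^\infty(B)$ such that the Hessian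 $\partial_i\partial_j\Psi$ is positive definite in the formal sense; and the data satisfy the conditions of a classical Legendre bundle for each fixed $u$. *)

theory Defs
  imports "HOL-Analysis.Analysis" "HOL-Computational_Algebra.Formal_Power_Series"
begin

section \<open>Smooth functions and formal functions on \<open>B \<times> D\<close>\<close>

primrec Ck_on :: "nat \<Rightarrow> 'a::real_normed_vector set \<Rightarrow> ('a \<Rightarrow> 'b::real_normed_vector) \<Rightarrow> bool" where
  "Ck_on 0 S f \<longleftrightarrow> continuous_on S f"
| "Ck_on (Suc k) S f \<longleftrightarrow>
     (\<forall>x\<in>S. f differentiable (at x)) \<and> (\<forall>v. Ck_on k S (\<lambda>x. frechet_derivative f (at x) v))"

text \<open>Intended for open \<open>S\<close> only.\<close>

definition smooth_on :: "'a::real_normed_vector set \<Rightarrow> ('a \<Rightarrow> 'b::real_normed_vector) \<Rightarrow> bool" where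
  "smooth_on S f \<longleftrightarrow> (\<forall>k. Ck_on k S f)"

text \<open>
  The base \<open>B\<close> is an open subset of \<open>\<real>\<^sup>n\<close>, that is, a manifold identified with its image under
  global coordinates.  Every real normed field is isomorphic to the reals or to the complex
  numbers, so a type variable of class \<open>real_normed_field\<close> renders the ground field \<open>k\<close>.

  A function on \<open>B \<times> D\<close> is a formal power series in \<open>u\<close> with smooth coefficients.  Functions and
  sections are normalised to vanish outside \<open>B\<close>, so that HOL equality is equality on \<open>B\<close>; the
  same convention, with \<open>U\<close> in place of \<open>B\<close>, is used for objects defined on an open subset \<open>U\<close>.
\<close>

type_synonym ('n, 'k) ffun = "real^'n \<Rightarrow> 'k fps"
type_synonym ('n, 'k) fsec = "real^'n \<Rightarrow> ('k fps)^'n"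
type_synonym ('n, 'k) fvec = "('n, 'k) fsec \<times> ('n, 'k) ffun"

definition formal_functions :: "(real^'n) set \<Rightarrow> ('n, 'k::real_normed_field) ffun set" where
  "formal_functions B =
     {f. (\<forall>m. smooth_on B (\<lambda>t. fps_nth (f t) m)) \<and> (\<forall>t. t \<notin> B \<longrightarrow> f t = 0)}"

definition lift_scalars :: "('n::finite, real) ffun \<Rightarrow> ('n, 'k::real_normed_field) ffun" where
  "lift_scalars f t = Abs_fps (\<lambda>m. of_real (fps_nth (f t) m))"

definition partial :: "(real^'n) set \<Rightarrow> 'n \<Rightarrow> ('n, 'k::real_normed_field) ffun \<Rightarrow> ('n, 'k) ffun" where
  "partial B a f t =
     (if t \<in> B then Abs_fps (\<lambda>m. frechet_derivative (\<lambda>x. fps_nth (f x) m) (at t) (axis a 1)) else 0)"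

text \<open>
  Sections of \<open>\<pi>\<^sup>*TB\<close> are given by their components in the frame \<open>\<partial>\<^sub>i\<close>, sections of \<open>\<pi>\<^sup>*T\<^sup>*B\<close> by
  their components in the coframe \<open>dt\<^sup>i\<close>, hence the same underlying set.
\<close>

definition tangent_sections :: "(real^'n) set \<Rightarrow> ('n, 'k::real_normed_field) fsec set" where
  "tangent_sections B = {X. \<forall>i. (\<lambda>t. X t $ i) \<in> formal_functions B}"

definition cotangent_sections :: "(real^'n) set \<Rightarrow> ('n, 'k::real_normed_field) fsec set" where
  "cotangent_sections B = {\<alpha>. \<forall>i. (\<lambda>t. \<alpha> t $ i) \<in> formal_functions B}"

definition coord_frame :: "(real^'n) set \<Rightarrow> 'n \<Rightarrow> ('n, 'k::real_normed_field) fsec" where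
  "coord_frame B i t = (if t \<in> B then axis i 1 else 0)"

section \<open>Vector fields on \<open>B \<times> D\<close>\<close>

text \<open>The pair \<open>(V, w)\<close> stands for \<open>\<Sum>\<^sub>a V\<^sup>a \<partial>\<^sub>a + w \<partial>\<^sub>u\<close>.\<close>

definition vector_fields :: "(real^'n) set \<Rightarrow> ('n, 'k::real_normed_field) fvec set" where
  "vector_fields B = tangent_sections B \<times> formal_functions B"

text \<open>
  Vector fields along \<open>B\<close>, with coefficients depending on \<open>u\<close>: an identity required for these only
  is one in which \<open>u\<close> is treated as a constant parameter.
\<close>

definition along :: "('n::finite, 'k::real_normed_field) fsec \<Rightarrow> ('n, 'k) fvec" where
  "along V = (V, \<lambda>_. 0)"

definition fixed_u_fields :: "(real^'n) set \<Rightarrow> ('n, 'k::real_normed_field) fvec set" where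
  "fixed_u_fields B = along ` tangent_sections B"

definition apply_vf ::
  "(real^'n) set \<Rightarrow> ('n, 'k::real_normed_field) fvec \<Rightarrow> ('n, 'k) ffun \<Rightarrow> ('n, 'k) ffun" where
  "apply_vf B Z f t = (\<Sum>a\<in>UNIV. fst Z t $ a * partial B a f t) + snd Z t * fps_deriv (f t)"

definition lie_bracket ::
  "(real^'n) set \<Rightarrow> ('n, 'k::real_normed_field) fvec \<Rightarrow> ('n, 'k) fvec \<Rightarrow> ('n, 'k) fvec" where
  "lie_bracket B Z W =
     (\<lambda>t. \<chi> a. apply_vf B Z (\<lambda>x. fst W x $ a) t - apply_vf B W (\<lambda>x. fst Z x $ a) t,
      \<lambda>t. apply_vf B Z (snd W) t - apply_vf B W (snd Z) t)"

section \<open>Connections\<close>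

text \<open>
  \<open>S\<close> is the module of sections of a bundle over \<open>B \<times> D\<close> and \<open>\<Z>\<close> the module of admissible vector
  fields: all of them, or those along \<open>B\<close> when \<open>u\<close> is held fixed.
\<close>

type_synonym ('n, 'k) fconn = "('n, 'k) fvec \<Rightarrow> ('n, 'k) fsec \<Rightarrow> ('n, 'k) fsec"

definition is_connection ::
  "(real^'n) set \<Rightarrow> ('n, 'k::real_normed_field) fvec set \<Rightarrow> ('n, 'k) fsec set \<Rightarrow> ('n, 'k) fconn \<Rightarrow> bool"
where
  "is_connection B \<Z> S \<D> \<longleftrightarrow>
     (\<forall>Z\<in>\<Z>. \<forall>X\<in>S. \<D> Z X \<in> S) \<and>
     (\<forall>f\<in>formal_functions B. \<forall>Z\<in>\<Z>. \<forall>W\<in>\<Z>. \<forall>X\<in>S.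
        \<D> (\<lambda>t. f t *s fst Z t + fst W t, \<lambda>t. f t * snd Z t + snd W t) X
          = (\<lambda>t. f t *s \<D> Z X t + \<D> W X t)) \<and>
     (\<forall>Z\<in>\<Z>. \<forall>X\<in>S. \<forall>Y\<in>S. \<D> Z (\<lambda>t. X t + Y t) = (\<lambda>t. \<D> Z X t + \<D> Z Y t)) \<and>
     (\<forall>f\<in>formal_functions B. \<forall>Z\<in>\<Z>. \<forall>X\<in>S.
        \<D> Z (\<lambda>t. f t *s X t) = (\<lambda>t. apply_vf B Z f t *s X t + f t *s \<D> Z X t))"

definition flat ::
  "(real^'n) set \<Rightarrow> ('n, 'k::real_normed_field) fvec set \<Rightarrow> ('n, 'k) fsec set \<Rightarrow> ('n, 'k) fconn \<Rightarrow> bool"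
where
  "flat B \<Z> S \<D> \<longleftrightarrow>
     (\<forall>Z\<in>\<Z>. \<forall>W\<in>\<Z>. \<forall>X\<in>S.
        (\<lambda>t. \<D> Z (\<D> W X) t - \<D> W (\<D> Z X) t) = \<D> (lie_bracket B Z W) X)"

definition torsion_free :: "(real^'n) set \<Rightarrow> ('n, 'k::real_normed_field) fconn \<Rightarrow> bool" where
  "torsion_free B \<D> \<longleftrightarrow>
     (\<forall>X\<in>tangent_sections B. \<forall>Y\<in>tangent_sections B.
        (\<lambda>t. \<D> (along X) Y t - \<D> (along Y) X t) = fst (lie_bracket B (along X) (along Y)))"

definition parallel ::
  "('n::finite, 'k::real_normed_field) fvec set \<Rightarrow> ('n, 'k) fconn \<Rightarrow> ('n, 'k) fsec \<Rightarrow> bool" where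
  "parallel \<Z> \<D> X \<longleftrightarrow> (\<forall>Z\<in>\<Z>. \<D> Z X = (\<lambda>_. 0))"

text \<open>
  The connection for which the frame \<open>E\<close> is parallel: \<open>\<D>\<^sub>Z (\<Sum>\<^sub>i c\<^sub>i E\<^sub>i) = \<Sum>\<^sub>i Z(c\<^sub>i) E\<^sub>i\<close>.
\<close>

definition frame_coeff ::
  "('n::finite \<Rightarrow> ('n, 'k::real_normed_field) fsec) \<Rightarrow> ('n, 'k) fsec \<Rightarrow> 'n \<Rightarrow> ('n, 'k) ffun" where
  "frame_coeff E X i t = (matrix_inv (\<chi> a j. E j t $ a) *v X t) $ i"

definition frame_connection ::
  "(real^'n) set \<Rightarrow> ('n \<Rightarrow> ('n, 'k::real_normed_field) fsec) \<Rightarrow> ('n, 'k) fconn" where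
  "frame_connection B E Z X t = (\<Sum>i\<in>UNIV. apply_vf B Z (frame_coeff E X i) t *s E i t)"

section \<open>Affine coordinates, Hessians, convexity\<close>

text \<open>
  \<open>\<theta>\<close> is a system of real coordinates on the open set \<open>U\<close> (for fixed \<open>u\<close>, in the formal sense), and
  \<open>X i\<close> is its coordinate vector field \<open>\<partial>/\<partial>\<theta>\<^sup>i\<close>.
\<close>

definition local_coordinates ::
  "(real^'n) set \<Rightarrow> ('n \<Rightarrow> ('n, real) ffun) \<Rightarrow> ('n \<Rightarrow> ('n, real) fsec) \<Rightarrow> bool" where
  "local_coordinates U \<theta> X \<longleftrightarrow>
     open U \<and> (\<forall>i. \<theta> i \<in> formal_functions U) \<and> (\<forall>i. X i \<in> tangent_sections U) \<and>
     inj_on (\<lambda>t. \<chi> i. fps_nth (\<theta> i t) 0) U \<and>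
     (\<forall>i j. \<forall>t\<in>U. apply_vf U (along (X i)) (\<theta> j) t = (if i = j then 1 else 0))"

text \<open>
  A connection \<open>\<D>\<close> on \<open>\<pi>\<^sup>*TB\<close> is restricted to \<open>U \<subseteq> B\<close> through its Christoffel symbols
  \<open>\<Gamma>\<^sub>a\<^sub>b = \<D>\<^bsub>\<partial>\<^sub>a\<^esub> \<partial>\<^sub>b\<close> in the global frame of \<open>B\<close>: the last condition says
  \<open>\<partial>\<^sub>a Y + \<Sum>\<^sub>b Y\<^sup>b \<Gamma>\<^sub>a\<^sub>b = 0\<close> for \<open>Y = X i\<close>, i.e. that \<open>X i\<close> is parallel on \<open>U\<close> along \<open>B\<close>.
\<close>

definition flat_coordinates ::
  "(real^'n) set \<Rightarrow> ('n, 'k::real_normed_field) fconn \<Rightarrow>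
   (real^'n) set \<Rightarrow> ('n \<Rightarrow> ('n, real) ffun) \<Rightarrow> ('n \<Rightarrow> ('n, real) fsec) \<Rightarrow> bool" where
  "flat_coordinates B \<D> U \<theta> X \<longleftrightarrow>
     U \<subseteq> B \<and> local_coordinates U \<theta> X \<and>
     (\<forall>i a c. \<forall>t\<in>U.
        partial U a (lift_scalars (\<lambda>x. X i x $ c)) t
        + (\<Sum>b\<in>UNIV. lift_scalars (\<lambda>x. X i x $ b) t
             * \<D> (along (coord_frame B a)) (coord_frame B b) t $ c) = 0)"

text \<open>Positive definiteness of a symmetric matrix, and of a matrix of power series in the formal sense.\<close>

definition pos_def :: "real^'n^'n \<Rightarrow> bool" where
  "pos_def A \<longleftrightarrow> (\<forall>v. v \<noteq> 0 \<longrightarrow> v \<bullet> (A *v v) > 0)"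

definition formal_pos_def :: "(real fps)^'n^'n \<Rightarrow> bool" where
  "formal_pos_def A \<longleftrightarrow> pos_def (\<chi> i j. fps_nth (A $ i $ j) 0)"

definition hessian :: "(real^'n) set \<Rightarrow> ('n, 'k::real_normed_field) ffun \<Rightarrow> real^'n \<Rightarrow> ('k fps)^'n^'n" where
  "hessian B f t = (\<chi> i j. partial B i (partial B j f) t)"

definition hessian_in ::
  "(real^'n) set \<Rightarrow> ('n \<Rightarrow> ('n, real) fsec) \<Rightarrow> ('n, real) ffun \<Rightarrow> real^'n \<Rightarrow> (real fps)^'n^'n" where
  "hessian_in U X f t = (\<chi> i j. apply_vf U (along (X i)) (apply_vf U (along (X j)) f) t)"

text \<open>Strict convexity in the formal sense: the constant term has positive definite Hessian.\<close>

definition formally_strictly_convex :: "(real^'n) set \<Rightarrow> ('n, real) ffun \<Rightarrow> bool" where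
  "formally_strictly_convex B F \<longleftrightarrow>
     (\<forall>t\<in>B. formal_pos_def (hessian B (\<lambda>x. fps_const (fps_nth (F x) 0)) t))"

text \<open>The same, with respect to the flat structure of \<open>\<D>\<close>, which is required to possess flat coordinates.\<close>

definition formally_strictly_convex_wrt ::
  "(real^'n) set \<Rightarrow> ('n, 'k::real_normed_field) fconn \<Rightarrow> ('n, real) ffun \<Rightarrow> bool" where
  "formally_strictly_convex_wrt B \<D> \<Psi> \<longleftrightarrow>
     (\<forall>p\<in>B. \<exists>U \<theta> X. p \<in> U \<and> flat_coordinates B \<D> U \<theta> X) \<and>
     (\<forall>U \<theta> X. flat_coordinates B \<D> U \<theta> X \<longrightarrow> (\<forall>t\<in>U. formal_pos_def (hessian_in U X \<Psi> t)))"

section \<open>Families of Legendre bundles\<close>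

text \<open>
  The bundle \<open>H = H\<^sup>+ \<oplus> H\<^sup>-\<close> is given by the modules of sections of its two summands; a section of
  \<open>H\<close> is a pair.
\<close>

record ('n, 'k) legendre_data =
  Hplus :: "('n, 'k) fsec set"
  Hminus :: "('n, 'k) fsec set"
  pairing :: "('n, 'k) fsec \<times> ('n, 'k) fsec \<Rightarrow> ('n, 'k) fsec \<times> ('n, 'k) fsec \<Rightarrow> ('n, 'k) ffun"
  nabla_plus :: "('n, 'k) fconn"
  nabla_minus :: "('n, 'k) fconn"
  potential :: "('n, real) ffun"

definition evaluation :: "('n::finite, 'k::real_normed_field) fsec \<Rightarrow> ('n, 'k) fsec \<Rightarrow> ('n, 'k) ffun" where
  "evaluation \<alpha> X t = (\<Sum>i\<in>UNIV. \<alpha> t $ i * X t $ i)"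

definition fscale :: "('n::finite, 'k::real_normed_field) ffun \<Rightarrow>
   ('n, 'k) fsec \<times> ('n, 'k) fsec \<Rightarrow> ('n, 'k) fsec \<times> ('n, 'k) fsec" where
  "fscale f s = (\<lambda>t. f t *s fst s t, \<lambda>t. f t *s snd s t)"

definition fplus :: "('n::finite, 'k::real_normed_field) fsec \<times> ('n, 'k) fsec \<Rightarrow>
   ('n, 'k) fsec \<times> ('n, 'k) fsec \<Rightarrow> ('n, 'k) fsec \<times> ('n, 'k) fsec" where
  "fplus s s' = (\<lambda>t. fst s t + fst s' t, \<lambda>t. snd s t + snd s' t)"

definition formal_linear :: "(real^'n) set \<Rightarrow> (('n, 'k::real_normed_field) fsec \<times> ('n, 'k) fsec) set \<Rightarrow>
   (('n, 'k) fsec \<times> ('n, 'k) fsec \<Rightarrow> ('n, 'k) ffun) \<Rightarrow> bool" where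
  "formal_linear B H \<phi> \<longleftrightarrow>
     (\<forall>s\<in>H. \<phi> s \<in> formal_functions B) \<and>
     (\<forall>f\<in>formal_functions B. \<forall>s\<in>H. \<phi> (fscale f s) = (\<lambda>t. f t * \<phi> s t)) \<and>
     (\<forall>s\<in>H. \<forall>s'\<in>H. \<phi> (fplus s s') = (\<lambda>t. \<phi> s t + \<phi> s' t))"

text \<open>Over the ring of formal functions, non-degeneracy means that \<open>H \<rightarrow> H\<^sup>*\<close> is an isomorphism.\<close>

definition nondegenerate_symmetric_form :: "(real^'n) set \<Rightarrow>
   (('n, 'k::real_normed_field) fsec \<times> ('n, 'k) fsec) set \<Rightarrow>
   (('n, 'k) fsec \<times> ('n, 'k) fsec \<Rightarrow> ('n, 'k) fsec \<times> ('n, 'k) fsec \<Rightarrow> ('n, 'k) ffun) \<Rightarrow> bool" where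
  "nondegenerate_symmetric_form B H \<beta> \<longleftrightarrow>
     (\<forall>s\<in>H. formal_linear B H (\<beta> s)) \<and>
     (\<forall>s\<in>H. \<forall>s'\<in>H. \<beta> s s' = \<beta> s' s) \<and>
     (\<forall>\<phi>. formal_linear B H \<phi> \<longrightarrow> (\<exists>!s. s \<in> H \<and> (\<forall>s'\<in>H. \<beta> s s' = \<phi> s')))"

text \<open>
  Bundle, pairing, and dual flat connections, where connections differentiate in the directions
  \<open>\<Z>\<close>.  The isomorphisms of \<open>H\<^sup>\<plusminus>\<close> with \<open>\<pi>\<^sup>*TB\<close> and \<open>\<pi>\<^sup>*T\<^sup>*B\<close> are taken to be identifications.
\<close>

definition legendre_axioms ::
  "(real^'n) set \<Rightarrow> ('n, 'k::real_normed_field) fvec set \<Rightarrow> ('n, 'k) legendre_data \<Rightarrow> bool" where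
  "legendre_axioms B \<Z> L \<longleftrightarrow>
     Hplus L = tangent_sections B \<and> Hminus L = cotangent_sections B \<and>
     nondegenerate_symmetric_form B (Hplus L \<times> Hminus L) (pairing L) \<and>
     (\<forall>X\<in>Hplus L. \<forall>Y\<in>Hplus L. pairing L (X, \<lambda>_. 0) (Y, \<lambda>_. 0) = (\<lambda>_. 0)) \<and>
     (\<forall>\<alpha>\<in>Hminus L. \<forall>\<beta>\<in>Hminus L. pairing L (\<lambda>_. 0, \<alpha>) (\<lambda>_. 0, \<beta>) = (\<lambda>_. 0)) \<and>
     (\<forall>X\<in>Hplus L. \<forall>\<alpha>\<in>Hminus L. pairing L (X, \<lambda>_. 0) (\<lambda>_. 0, \<alpha>) = evaluation \<alpha> X) \<and>
     is_connection B \<Z> (Hplus L) (nabla_plus L) \<and> flat B \<Z> (Hplus L) (nabla_plus L) \<and>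
     is_connection B \<Z> (Hminus L) (nabla_minus L) \<and> flat B \<Z> (Hminus L) (nabla_minus L) \<and>
     (\<forall>Z\<in>\<Z>. \<forall>X\<in>Hplus L. \<forall>\<alpha>\<in>Hminus L.
        apply_vf B Z (pairing L (X, \<lambda>_. 0) (\<lambda>_. 0, \<alpha>)) =
        (\<lambda>t. pairing L (nabla_plus L Z X, \<lambda>_. 0) (\<lambda>_. 0, \<alpha>) t
           + pairing L (X, \<lambda>_. 0) (\<lambda>_. 0, nabla_minus L Z \<alpha>) t))"

text \<open>The conditions of a classical Legendre bundle, for each fixed \<open>u\<close>.\<close>

definition classical_legendre_fixed_u ::
  "(real^'n) set \<Rightarrow> ('n, 'k::real_normed_field) legendre_data \<Rightarrow> bool" where
  "classical_legendre_fixed_u B L \<longleftrightarrow>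
     legendre_axioms B (fixed_u_fields B) L \<and>
     torsion_free B (nabla_plus L) \<and>
     potential L \<in> formal_functions B \<and>
     formally_strictly_convex_wrt B (nabla_plus L) (potential L)"

definition legendre_family ::
  "(real^'n) set \<Rightarrow> ('n, 'k::real_normed_field) legendre_data \<Rightarrow> bool" where
  "legendre_family B L \<longleftrightarrow>
     open B \<and> legendre_axioms B (vector_fields B) L \<and> classical_legendre_fixed_u B L"

definition canonical_pairing ::
  "('n::finite, 'k::real_normed_field) fsec \<times> ('n, 'k) fsec \<Rightarrow> ('n, 'k) fsec \<times> ('n, 'k) fsec \<Rightarrow> ('n, 'k) ffun"
where
  "canonical_pairing s s' t = evaluation (snd s') (fst s) t + evaluation (snd s) (fst s') t"

section \<open>Dually flat structures and Hessian quantum field theories\<close>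

text \<open>For fixed \<open>u\<close>; the local potentials are expressed as functions on \<open>U\<close>.\<close>

definition dually_flat ::
  "(real^'n) set \<Rightarrow> (real^'n \<Rightarrow> (real fps)^'n^'n) \<Rightarrow> ('n, real) fconn \<Rightarrow> ('n, real) fconn \<Rightarrow> bool" where
  "dually_flat B g \<D> \<D>' \<longleftrightarrow>
     (\<forall>i j. (\<lambda>t. g t $ i $ j) \<in> formal_functions B) \<and>
     (\<forall>t\<in>B. transpose (g t) = g t \<and> formal_pos_def (g t)) \<and>
     (\<forall>E\<in>{\<D>, \<D>'}. is_connection B (fixed_u_fields B) (tangent_sections B) E \<and>
        flat B (fixed_u_fields B) (tangent_sections B) E \<and> torsion_free B E) \<and>
     (\<forall>Z\<in>fixed_u_fields B. \<forall>X\<in>tangent_sections B. \<forall>Y\<in>tangent_sections B.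
        apply_vf B Z (\<lambda>t. evaluation (\<lambda>x. X x v* g x) Y t) =
        (\<lambda>t. evaluation (\<lambda>x. \<D> Z X x v* g x) Y t + evaluation (\<lambda>x. X x v* g x) (\<D>' Z Y) t)) \<and>
     (\<forall>p\<in>B. \<exists>U \<theta> X \<eta> Y. \<exists>\<Psi>\<in>formal_functions U. \<exists>\<Psi>'\<in>formal_functions U.
        p \<in> U \<and> flat_coordinates B \<D> U \<theta> X \<and> flat_coordinates B \<D>' U \<eta> Y \<and>
        (\<forall>i. \<eta> i = apply_vf U (along (X i)) \<Psi>) \<and>
        (\<forall>i j. \<forall>t\<in>U. evaluation (\<lambda>x. X i x v* g x) (X j) t = hessian_in U X \<Psi> t $ i $ j) \<and>
        (\<forall>t. \<Psi> t + \<Psi>' t = (\<Sum>i\<in>UNIV. \<theta> i t * \<eta> i t)))"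

text \<open>
  The dual affine coordinates \<open>\<eta>\<^sub>i = \<partial>\<^sub>i F\<close>, their coordinate vector fields \<open>\<partial>/\<partial>\<eta>\<^sub>i\<close> (the columns of the
  inverse of the Jacobian matrix \<open>(\<partial>\<^sub>a \<eta>\<^sub>j)\<close>), and the coframe \<open>g(\<partial>/\<partial>\<eta>\<^sub>i, _)\<close>.
\<close>

definition dual_coord :: "(real^'n) set \<Rightarrow> ('n, 'k::real_normed_field) ffun \<Rightarrow> 'n \<Rightarrow> ('n, 'k) ffun" where
  "dual_coord B F i = partial B i F"

definition dual_frame :: "(real^'n) set \<Rightarrow> ('n, 'k::real_normed_field) ffun \<Rightarrow> 'n \<Rightarrow> ('n, 'k) fsec" where
  "dual_frame B F i t =
     (if t \<in> B then column i (matrix_inv (\<chi> j a. partial B a (dual_coord B F j) t)) else 0)"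

definition dual_coframe :: "(real^'n) set \<Rightarrow> ('n, 'k::real_normed_field) ffun \<Rightarrow> 'n \<Rightarrow> ('n, 'k) fsec" where
  "dual_coframe B F i t = dual_frame B F i t v* hessian B F t"

text \<open>
  For manifolds with global affine coordinates \<open>T\<close> is the image of the coordinate map, so it is only
  required to be open; open convex subsets are a special case.
\<close>

definition hessian_qft :: "(real^'n) set \<Rightarrow> ('n, real) ffun \<Rightarrow> bool" where
  "hessian_qft T F \<longleftrightarrow>
     open T \<and> F \<in> formal_functions T \<and> formally_strictly_convex T F \<and>
     (\<forall>t\<in>T. formal_pos_def (hessian T F t)) \<and>
     dually_flat T (hessian T F)
       (frame_connection T (coord_frame T)) (frame_connection T (dual_frame T F))"

end

theory Submission
  imports Defs
begin

text \<open>
  Pairing the frame \<open>\<partial>/\<partial>\<eta>\<^sub>i\<close> with the Hessian metric gives back \<open>dt\<^sup>i\<close>: the Jacobian of \<open>\<eta> = dF\<close> is the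
  Hessian of \<open>F\<close>, which is symmetric, and invertible over the formal power series because its
  constant term is positive definite.  Hence \<open>\<nabla>\<^sup>+\<close> and \<open>\<nabla>\<^sup>-\<close> both differentiate components in the
  coordinate frame, duality is the Leibniz rule, and flatness is
  \<open>Z (W f) - W (Z f) = [Z, W] f\<close>, that is, symmetry of second derivatives.
\<close>

section \<open>Smooth functions\<close>

text \<open>The dual coordinates \<open>\<eta>\<^sub>i\<close>, and with them the fields
  \<open>\<partial>/\<partial>\<eta>\<^sub>i\<close>, vary with \<open>u\<close> through
  \<open>F\<close>. Transport by \<open>g\<close> cancels this variation, because the same Hessian
  is inverted and then multiplied back; this is why \<open>\<nabla>\<^sup>-\<close> can have its
  coframe parallel along \<open>\<partial>\<^sub>u\<close> as well. Two conditions of a Legendre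
  family call for arguments of their own. Non-degeneracy means that \<open>H\<close> is isomorphic
  to its dual over the formal functions, so every linear functional on sections has to be
  represented by a unique pair of sections. Convexity is demanded in every flat chart on every open
  subset, not only in the given affine coordinates, so unknown flat frames must be compared with the
  coordinate frame. Positivity concerns real series while the connections live over
  \<open>k\<close>; the Hessian and the inverse of its constant term are carried across by
  \<open>of_real\<close>.\<close>

lemma Ck_on_cong:
  assumes "open S" "\<And>x. x \<in> S \<Longrightarrow> f x = g x" "Ck_on k S f"
  shows "Ck_on k S g"
  using assms(2,3)
proof (induction k arbitrary: f g)
  case 0
  then show ?case by (simp cong: continuous_on_cong)
next
  case (Suc k)
  \<comment> \<open>\<open>frechet_derivative\<close> is taken in the ambient space and could see
    values of \<open>g\<close> off \<open>S\<close>; openness provides a neighbourhood of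
    \<open>x\<close> on which \<open>f\<close> and \<open>g\<close> agree.\<close>
  have der: "(g has_derivative frechet_derivative f (at x)) (at x)" if "x \<in> S" for x
    using Suc.prems that assms(1)
    by (auto intro!: has_derivative_transform_within_open[of f _ x UNIV S g]
        simp: frechet_derivative_works)
  have "g differentiable (at x)" if "x \<in> S" for x
    using der[OF that] by (auto simp: differentiable_def)
  moreover have "Ck_on k S (\<lambda>x. frechet_derivative g (at x) v)" for v
  proof (rule Suc.IH)
    show "frechet_derivative f (at x) v = frechet_derivative g (at x) v" if "x \<in> S" for x
      by (rule fun_cong[OF frechet_derivative_at[OF der[OF that]]])
  qed (use Suc.prems in auto)
  ultimately show ?case by simp
qed

text \<open>The recursion peels derivatives off the front, so lowering the order takes an induction,
  which ends in the fact that differentiable functions are continuous.\<close>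

lemma Ck_on_SucD: "Ck_on (Suc k) S f \<Longrightarrow> Ck_on k S f"
proof (induction k arbitrary: f)
  case 0
  then show ?case
    by (auto intro!: continuous_at_imp_continuous_on differentiable_imp_continuous_within)
next
  case (Suc k)
  have "Ck_on k S (\<lambda>x. frechet_derivative f (at x) v)" for v
    using Suc.prems Ck_on.simps(2)[of "Suc k" S f] by (intro Suc.IH) blast
  then show ?case using Suc.prems Ck_on.simps(2)[of _ S f] by blast
qed

lemma Ck_on_const [simp]: "Ck_on k S (\<lambda>_. c)"
  by (induction k arbitrary: c) auto

lemma Ck_on_bounded_linear:
  assumes "open S" "bounded_linear L" "Ck_on k S f"
  shows "Ck_on k S (\<lambda>x. L (f x))"
  using assms(3)
proof (induction k arbitrary: f)
  case 0
  then show ?case using assms(2) by (simp add: bounded_linear.continuous_on)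
next
  case (Suc k)
  have der: "((\<lambda>x. L (f x)) has_derivative (\<lambda>v. L (frechet_derivative f (at x) v))) (at x)"
    if "x \<in> S" for x
    using Suc.prems that
    by (auto intro!: bounded_linear.has_derivative[OF assms(2)] simp: frechet_derivative_works)
  have "Ck_on k S (\<lambda>x. frechet_derivative (\<lambda>x. L (f x)) (at x) v)" for v
  proof (rule Ck_on_cong[OF assms(1)])
    show "Ck_on k S (\<lambda>x. L (frechet_derivative f (at x) v))"
      using Suc by auto
  qed (rule fun_cong[OF frechet_derivative_at[OF der]])
  then show ?case using der by (auto simp: differentiable_def)
qed

lemma Ck_on_add:
  assumes "open S" "Ck_on k S f" "Ck_on k S g"
  shows "Ck_on k S (\<lambda>x. f x + g x)"
  using assms(2,3)
proof (induction k arbitrary: f g)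
  case 0
  then show ?case by (simp add: continuous_on_add)
next
  case (Suc k)
  have der: "((\<lambda>x. f x + g x) has_derivative
      (\<lambda>v. frechet_derivative f (at x) v + frechet_derivative g (at x) v)) (at x)"
    if "x \<in> S" for x
    using Suc.prems that by (auto intro!: has_derivative_add simp: frechet_derivative_works)
  have "Ck_on k S (\<lambda>x. frechet_derivative (\<lambda>x. f x + g x) (at x) v)" for v
  proof (rule Ck_on_cong[OF assms(1)])
    show "Ck_on k S (\<lambda>x. frechet_derivative f (at x) v + frechet_derivative g (at x) v)"
      using Suc by auto
  qed (rule fun_cong[OF frechet_derivative_at[OF der]])
  then show ?case using der by (auto simp: differentiable_def)
qed

text \<open>The Leibniz rule mixes undifferentiated and differentiated factors, while the induction
  hypothesis wants both at order \<open>k\<close>; \<open>Ck_on_SucD\<close> lowers the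
  undifferentiated ones.\<close>

lemma Ck_on_mult:
  fixes f g :: "'a::real_normed_vector \<Rightarrow> 'b::real_normed_algebra"
  assumes "open S" "Ck_on k S f" "Ck_on k S g"
  shows "Ck_on k S (\<lambda>x. f x * g x)"
  using assms(2,3)
proof (induction k arbitrary: f g)
  case 0
  then show ?case by (simp add: continuous_on_mult)
next
  case (Suc k)
  have der: "((\<lambda>x. f x * g x) has_derivative
      (\<lambda>v. f x * frechet_derivative g (at x) v + frechet_derivative f (at x) v * g x)) (at x)"
    if "x \<in> S" for x
    using Suc.prems that by (auto intro!: has_derivative_mult simp: frechet_derivative_works)
  have "Ck_on k S (\<lambda>x. frechet_derivative (\<lambda>x. f x * g x) (at x) v)" for v
  proof (rule Ck_on_cong[OF assms(1)])
    show "Ck_on k S (\<lambda>x. f x * frechet_derivative g (at x) v + frechet_derivative f (at x) v * g x)"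
      using Suc.prems Ck_on_SucD[OF Suc.prems(1)] Ck_on_SucD[OF Suc.prems(2)]
      by (intro Ck_on_add assms(1) Suc.IH) auto
  qed (rule fun_cong[OF frechet_derivative_at[OF der]])
  then show ?case using der by (auto simp: differentiable_def)
qed

lemma Ck_on_subset: "Ck_on k S f \<Longrightarrow> U \<subseteq> S \<Longrightarrow> Ck_on k U f"
proof (induction k arbitrary: f)
  case 0
  then show ?case by (simp add: continuous_on_subset)
next
  case (Suc k)
  have "Ck_on k U (\<lambda>x. frechet_derivative f (at x) v)" for v
    using Suc.prems by (intro Suc.IH) auto
  then show ?case using Suc.prems by auto
qed

lemma smooth_on_cong:
  "open S \<Longrightarrow> (\<And>x. x \<in> S \<Longrightarrow> f x = g x) \<Longrightarrow> smooth_on S f \<Longrightarrow> smooth_on S g"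
  unfolding smooth_on_def using Ck_on_cong by blast

lemma smooth_on_const [simp]: "smooth_on S (\<lambda>_. c)"
  by (simp add: smooth_on_def)

lemma smooth_on_bounded_linear:
  "open S \<Longrightarrow> bounded_linear L \<Longrightarrow> smooth_on S f \<Longrightarrow> smooth_on S (\<lambda>x. L (f x))"
  by (simp add: smooth_on_def Ck_on_bounded_linear)

lemma smooth_on_add:
  "open S \<Longrightarrow> smooth_on S f \<Longrightarrow> smooth_on S g \<Longrightarrow> smooth_on S (\<lambda>x. f x + g x)"
  by (simp add: smooth_on_def Ck_on_add)

lemma smooth_on_mult:
  fixes f g :: "'a::real_normed_vector \<Rightarrow> 'b::real_normed_algebra"
  shows "open S \<Longrightarrow> smooth_on S f \<Longrightarrow> smooth_on S g \<Longrightarrow> smooth_on S (\<lambda>x. f x * g x)"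
  by (simp add: smooth_on_def Ck_on_mult)

lemma smooth_on_sum:
  assumes "open S" "\<And>i. i \<in> I \<Longrightarrow> smooth_on S (f i)"
  shows "smooth_on S (\<lambda>x. \<Sum>i\<in>I. f i x)"
  using assms(2) by (induction I rule: infinite_finite_induct) (auto intro: smooth_on_add assms(1))

lemma smooth_on_subset: "smooth_on S f \<Longrightarrow> U \<subseteq> S \<Longrightarrow> smooth_on U f"
  unfolding smooth_on_def using Ck_on_subset by blast

lemma smooth_on_differentiable: "smooth_on S f \<Longrightarrow> x \<in> S \<Longrightarrow> f differentiable (at x)"
  unfolding smooth_on_def using Ck_on.simps(2)[of 0 S f] by blast

lemma smooth_on_frechet_derivative:
  "smooth_on S f \<Longrightarrow> smooth_on S (\<lambda>x. frechet_derivative f (at x) v)"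
  unfolding smooth_on_def using Ck_on.simps(2)[of _ S f] by blast

lemma smooth_on_ident:
  assumes "open S" shows "smooth_on S (\<lambda>x. x)"
proof -
  have "Ck_on k S (\<lambda>x. x)" for k by (cases k) auto
  then show ?thesis by (simp add: smooth_on_def)
qed

section \<open>Symmetry of second derivatives\<close>

lemma norm_increment_le:
  fixes f :: "real \<Rightarrow> 'b::real_normed_vector"
  assumes "0 \<le> h" "\<And>t. t \<in> {0..h} \<Longrightarrow> (f has_vector_derivative f' t) (at t)"
    and "\<And>t. t \<in> {0..h} \<Longrightarrow> norm (f' t - c) \<le> B"
  shows "norm (f h - f 0 - h *\<^sub>R c) \<le> B * h"
proof -
  \<comment> \<open>Mean value inequality for \<open>f t - t *\<^sub>R c\<close>, whose derivative
    \<open>f' t - c\<close> is bounded by \<open>B\<close>.\<close>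
  have "norm ((f h - h *\<^sub>R c) - (f 0 - 0 *\<^sub>R c)) \<le> B * norm (h - 0)"
  proof (rule differentiable_bound[where S = "{0..h}" and f' = "\<lambda>t s. s *\<^sub>R (f' t - c)"])
    fix t assume t: "t \<in> {0..h}"
    have "((\<lambda>t. t *\<^sub>R c) has_vector_derivative c) (at t)"
      by (auto intro!: derivative_eq_intros)
    from has_vector_derivative_diff[OF assms(2)[OF t] this]
    show "((\<lambda>t. f t - t *\<^sub>R c) has_derivative (\<lambda>s. s *\<^sub>R (f' t - c))) (at t within {0..h})"
      by (simp add: has_vector_derivative_def has_derivative_at_withinI)
    show "onorm (\<lambda>s. s *\<^sub>R (f' t - c)) \<le> B"
      by (rule onorm_le) (use mult_left_mono[OF assms(3)[OF t] abs_ge_zero] in \<open>simp add: mult.commute[of B]\<close>)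
  qed (use assms(1) in auto)
  then show ?thesis using assms(1) by (simp add: algebra_simps)
qed

lemma frechet_derivative_line:
  assumes "f differentiable (at (x + s *\<^sub>R v))"
  shows "((\<lambda>s. f (x + s *\<^sub>R v)) has_vector_derivative frechet_derivative f (at (x + s *\<^sub>R v)) v) (at s)"
proof -
  let ?D = "frechet_derivative f (at (x + s *\<^sub>R v))"
  have D: "(f has_derivative ?D) (at (x + s *\<^sub>R v))"
    using assms by (simp add: frechet_derivative_works)
  have "((\<lambda>s. x + s *\<^sub>R v) has_derivative (\<lambda>r. r *\<^sub>R v)) (at s)"
    by (auto intro!: derivative_eq_intros)
  from has_derivative_compose[OF this D]
  show ?thesis
    using linear_frechet_derivative[OF assms]
    by (simp add: has_vector_derivative_def linear_scale)
qed

text \<open>By continuity the mixed derivative \<open>K\<close> stays within \<open>e\<close> of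
  \<open>c\<close> on the small parallelogram spanned by \<open>h *\<^sub>R v\<close> and
  \<open>h *\<^sub>R w\<close>. Two applications of \<open>norm_increment_le\<close>, one per side,
  turn this into a bound on the second difference.\<close>

lemma second_difference_bound:
  fixes f :: "'a::real_normed_vector \<Rightarrow> 'b::real_normed_vector" and v w x :: 'a
  assumes "open S" "smooth_on S f" "x \<in> S" "e > 0"
  defines "c \<equiv> frechet_derivative (\<lambda>y. frechet_derivative f (at y) v) (at x) w"
  shows "\<exists>d>0. \<forall>h. 0 < h \<and> h < d \<longrightarrow>
    norm (f (x + h *\<^sub>R v + h *\<^sub>R w) - f (x + h *\<^sub>R v) - f (x + h *\<^sub>R w) + f x - h *\<^sub>R h *\<^sub>R c) \<le> e * h * h"
proof -
  define G where "G y = frechet_derivative f (at y) v" for y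
  define K where "K y = frechet_derivative G (at y) w" for y
  have sG: "smooth_on S G" and sK: "smooth_on S K"
    using assms(2) unfolding G_def[abs_def] K_def[abs_def]
    by (simp_all add: smooth_on_frechet_derivative)
  have "isCont K x"
    using smooth_on_differentiable[OF sK assms(3)] differentiable_imp_continuous_within by blast
  then obtain r1 where r1: "r1 > 0" "\<And>y. dist y x < r1 \<Longrightarrow> dist (K y) (K x) < e"
    unfolding continuous_at_eps_delta using assms(4) by blast
  obtain r2 where r2: "r2 > 0" "\<And>y. dist y x < r2 \<Longrightarrow> y \<in> S"
    using assms(1,3) unfolding open_dist by blast
  define r where "r = min r1 r2"
  \<comment> \<open>Points of the parallelogram lie within \<open>h * (norm v + norm w)\<close> of
    \<open>x\<close>; the extra 1 keeps the denominator positive when both vectors vanish.\<close>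
  define d where "d = r / (norm v + norm w + 1)"
  have nz: "norm v + norm w + 1 > 0" by (simp add: add_nonneg_pos)
  have "d > 0" using r1 r2 nz by (simp add: d_def r_def)
  moreover have "norm (f (x + h *\<^sub>R v + h *\<^sub>R w) - f (x + h *\<^sub>R v) - f (x + h *\<^sub>R w) + f x - h *\<^sub>R h *\<^sub>R c)
      \<le> e * h * h" if h: "0 < h" "h < d" for h
  proof -
    have near: "x + s *\<^sub>R v + t *\<^sub>R w \<in> S \<and> norm (K (x + s *\<^sub>R v + t *\<^sub>R w) - c) \<le> e"
      if "s \<in> {0..h}" "t \<in> {0..h}" for s t
    proof -
      have "norm (s *\<^sub>R v + t *\<^sub>R w) \<le> h * norm v + h * norm w"
        using that by (intro norm_triangle_le add_mono) (auto intro: mult_right_mono)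
      also have "\<dots> \<le> h * (norm v + norm w + 1)" using h by (simp add: algebra_simps)
      also have "\<dots> < r" using h nz by (simp add: d_def field_simps)
      finally have "dist (x + s *\<^sub>R v + t *\<^sub>R w) x < r" by (simp add: dist_norm add.assoc)
      then show ?thesis
        using r1(2)[of "x + s *\<^sub>R v + t *\<^sub>R w"] r2(2)[of "x + s *\<^sub>R v + t *\<^sub>R w"]
        by (auto simp: r_def c_def K_def G_def[abs_def] dist_norm)
    qed
    have inner: "norm (G (x + s *\<^sub>R v + h *\<^sub>R w) - G (x + s *\<^sub>R v) - h *\<^sub>R c) \<le> e * h"
      if s: "s \<in> {0..h}" for s
    proof -
      have "norm (G (x + s *\<^sub>R v + h *\<^sub>R w) - G (x + s *\<^sub>R v + 0 *\<^sub>R w) - h *\<^sub>R c) \<le> e * h"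
      proof (rule norm_increment_le[where f = "\<lambda>t. G (x + s *\<^sub>R v + t *\<^sub>R w)"
            and f' = "\<lambda>t. K (x + s *\<^sub>R v + t *\<^sub>R w)"])
        fix t assume t: "t \<in> {0..h}"
        show "((\<lambda>t. G (x + s *\<^sub>R v + t *\<^sub>R w)) has_vector_derivative
            K (x + s *\<^sub>R v + t *\<^sub>R w)) (at t)"
          unfolding K_def
          by (rule frechet_derivative_line, rule smooth_on_differentiable[OF sG],
              rule conjunct1[OF near[OF s t]])
        show "norm (K (x + s *\<^sub>R v + t *\<^sub>R w) - c) \<le> e"
          by (rule conjunct2[OF near[OF s t]])
      qed (use h in auto)
      then show ?thesis by simp
    qed
    \<comment> \<open>The difference of \<open>f\<close> across two opposite points of the sides
      parallel to \<open>v\<close>. Its derivative in \<open>s\<close> is the increment of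
      \<open>G\<close> in direction \<open>w\<close>, which \<open>inner\<close> controls.\<close>
    let ?p = "\<lambda>s. f (x + h *\<^sub>R w + s *\<^sub>R v) - f (x + s *\<^sub>R v)"
    have "norm (?p h - ?p 0 - h *\<^sub>R (h *\<^sub>R c)) \<le> e * h * h"
    proof (rule norm_increment_le[where f = ?p
            and f' = "\<lambda>s. G (x + h *\<^sub>R w + s *\<^sub>R v) - G (x + s *\<^sub>R v)"])
      fix s assume s: "s \<in> {0..h}"
      have "x + h *\<^sub>R w + s *\<^sub>R v \<in> S" "x + s *\<^sub>R v \<in> S"
        using near[OF s, of h] near[OF s, of 0] h by (simp_all add: add.assoc add.commute[of "h *\<^sub>R w"])
      then show "(?p has_vector_derivative G (x + h *\<^sub>R w + s *\<^sub>R v) - G (x + s *\<^sub>R v)) (at s)"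
        unfolding G_def
        by (intro has_vector_derivative_diff frechet_derivative_line smooth_on_differentiable[OF assms(2)])
      show "norm (G (x + h *\<^sub>R w + s *\<^sub>R v) - G (x + s *\<^sub>R v) - h *\<^sub>R c) \<le> e * h"
        using inner[OF s] by (simp add: add.assoc add.commute[of "h *\<^sub>R w"])
    qed (use h in auto)
    then show ?thesis by (simp add: add.assoc add.commute[of "h *\<^sub>R w"] diff_diff_eq2 diff_add_eq)
  qed
  ultimately show ?thesis by blast
qed

text \<open>The second difference is unchanged when \<open>v\<close> and \<open>w\<close> are
  swapped, so after division by \<open>h * h\<close> it lies within \<open>e / 2\<close> of both
  iterated derivatives.\<close>

lemma frechet_derivative_commute:
  fixes f :: "'a::real_normed_vector \<Rightarrow> 'b::real_normed_vector"
  assumes "open S" "smooth_on S f" "x \<in> S"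
  shows "frechet_derivative (\<lambda>y. frechet_derivative f (at y) v) (at x) w =
    frechet_derivative (\<lambda>y. frechet_derivative f (at y) w) (at x) v" (is "?a = ?b")
proof -
  have "norm (?a - ?b) \<le> 0 + e" if "e > 0" for e
  proof -
    from that have e: "e / 2 > 0" by simp
    obtain d1 where d1: "d1 > 0" "\<And>h. 0 < h \<and> h < d1 \<Longrightarrow> norm (f (x + h *\<^sub>R v + h *\<^sub>R w)
        - f (x + h *\<^sub>R v) - f (x + h *\<^sub>R w) + f x - h *\<^sub>R h *\<^sub>R ?a) \<le> e / 2 * h * h"
      using second_difference_bound[OF assms e] by blast
    obtain d2 where d2: "d2 > 0" "\<And>h. 0 < h \<and> h < d2 \<Longrightarrow> norm (f (x + h *\<^sub>R w + h *\<^sub>R v)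
        - f (x + h *\<^sub>R w) - f (x + h *\<^sub>R v) + f x - h *\<^sub>R h *\<^sub>R ?b) \<le> e / 2 * h * h"
      using second_difference_bound[OF assms e] by blast
    define h where "h = min d1 d2 / 2"
    have h: "0 < h" "h < d1" "h < d2" using d1(1) d2(1) by (auto simp: h_def)
    let ?P = "f (x + h *\<^sub>R v + h *\<^sub>R w) - f (x + h *\<^sub>R v) - f (x + h *\<^sub>R w) + f x"
    have A: "norm (?P - h *\<^sub>R h *\<^sub>R ?a) \<le> e / 2 * h * h" using d1(2) h by blast
    have B: "norm (?P - h *\<^sub>R h *\<^sub>R ?b) \<le> e / 2 * h * h"
      using d2(2)[of h] h by (simp add: algebra_simps)
    have "norm ((h * h) *\<^sub>R (?a - ?b)) = norm ((?P - h *\<^sub>R h *\<^sub>R ?b) - (?P - h *\<^sub>R h *\<^sub>R ?a))"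
      by (simp add: algebra_simps)
    also have "\<dots> \<le> e / 2 * h * h + e / 2 * h * h"
      using A B norm_triangle_ineq4 by (meson add_mono order_trans)
    finally have "(h * h) * norm (?a - ?b) \<le> (h * h) * e"
      unfolding norm_scaleR by (simp add: field_simps)
    then show ?thesis using h(1) by simp
  qed
  then have "norm (?a - ?b) \<le> 0" by (rule field_le_epsilon)
  then show ?thesis by simp
qed

section \<open>Derivations of formal functions\<close>

lemma formal_functionsI:
  "(\<And>m. smooth_on B (\<lambda>t. fps_nth (f t) m)) \<Longrightarrow> (\<And>t. t \<notin> B \<Longrightarrow> f t = 0) \<Longrightarrow> f \<in> formal_functions B"
  by (simp add: formal_functions_def)

lemma formal_functions_smooth: "f \<in> formal_functions B \<Longrightarrow> smooth_on B (\<lambda>t. fps_nth (f t) m)"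
  by (simp add: formal_functions_def)

lemma formal_functions_outside: "f \<in> formal_functions B \<Longrightarrow> t \<notin> B \<Longrightarrow> f t = 0"
  by (simp add: formal_functions_def)

lemma formal_functions_has_derivative:
  "f \<in> formal_functions B \<Longrightarrow> t \<in> B \<Longrightarrow>
    ((\<lambda>x. fps_nth (f x) m) has_derivative frechet_derivative (\<lambda>x. fps_nth (f x) m) (at t)) (at t)"
  using formal_functions_smooth smooth_on_differentiable frechet_derivative_works by blast

lemma fps_nth_partial:
  "t \<in> B \<Longrightarrow> fps_nth (partial B a f t) m =
    frechet_derivative (\<lambda>x. fps_nth (f x) m) (at t) (axis a 1)"
  by (simp add: partial_def)

lemma partial_outside [simp]: "t \<notin> B \<Longrightarrow> partial B a f t = 0"
  by (simp add: partial_def)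

lemma tangent_sectionsD: "X \<in> tangent_sections B \<Longrightarrow> (\<lambda>t. X t $ i) \<in> formal_functions B"
  by (simp add: tangent_sections_def)

lemma tangent_sections_outside: "X \<in> tangent_sections B \<Longrightarrow> t \<notin> B \<Longrightarrow> X t = 0"
  by (simp add: tangent_sections_def formal_functions_def vec_eq_iff)

lemma cotangent_sections_eq: "cotangent_sections B = tangent_sections B"
  by (simp add: cotangent_sections_def tangent_sections_def)

lemma vector_fieldsD:
  assumes "Z \<in> vector_fields B"
  shows "fst Z \<in> tangent_sections B" "snd Z \<in> formal_functions B"
    "(\<lambda>t. fst Z t $ a) \<in> formal_functions B"
  using assms by (auto simp: vector_fields_def tangent_sections_def)

lemma formal_functions_zero: "(\<lambda>_. 0) \<in> formal_functions B"
  by (intro formal_functionsI) simp_all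

lemma fixed_u_fields_subset: "fixed_u_fields B \<subseteq> vector_fields B"
  by (auto simp: fixed_u_fields_def along_def vector_fields_def formal_functions_zero)

lemma apply_vf_outside:
  "Z \<in> vector_fields B \<Longrightarrow> t \<notin> B \<Longrightarrow> apply_vf B Z f t = 0"
  by (auto simp: apply_vf_def dest: vector_fieldsD(2) formal_functions_outside)

context
  fixes B :: "(real^'n) set"
  assumes open_B: "open B"
begin

text \<open>Since functions vanish off \<open>B\<close>, this is the form that a constant takes in
  the ring of formal functions.\<close>

lemma formal_functions_indicator: "(\<lambda>t. if t \<in> B then c else 0) \<in> formal_functions B"
  by (rule formal_functionsI)
     (auto intro!: smooth_on_cong[OF open_B _ smooth_on_const[where c = "fps_nth c _"]])

lemma formal_functions_add:
  "f \<in> formal_functions B \<Longrightarrow> g \<in> formal_functions B \<Longrightarrow> (\<lambda>t. f t + g t) \<in> formal_functions B"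
  by (auto simp: formal_functions_def intro: smooth_on_add open_B)

lemma formal_functions_mult:
  "f \<in> formal_functions B \<Longrightarrow> g \<in> formal_functions B \<Longrightarrow> (\<lambda>t. f t * g t) \<in> formal_functions B"
  by (auto simp: formal_functions_def fps_mult_nth intro!: smooth_on_sum smooth_on_mult open_B)

lemma formal_functions_diff:
  assumes "f \<in> formal_functions B" "g \<in> formal_functions B"
  shows "(\<lambda>t. f t - g t) \<in> formal_functions B"
proof -
  have "(\<lambda>t. (if t \<in> B then - 1 else 0) * g t) \<in> formal_functions B"
    by (intro formal_functions_mult formal_functions_indicator assms)
  then have "(\<lambda>t. f t + (if t \<in> B then - 1 else 0) * g t) \<in> formal_functions B"
    by (intro formal_functions_add assms)
  also have "(\<lambda>t. f t + (if t \<in> B then - 1 else 0) * g t) = (\<lambda>t. f t - g t)"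
    using assms(2) by (auto simp: fun_eq_iff formal_functions_outside)
  finally show ?thesis .
qed

lemma formal_functions_sum:
  "(\<And>i. i \<in> I \<Longrightarrow> f i \<in> formal_functions B) \<Longrightarrow> (\<lambda>t. \<Sum>i\<in>I. f i t) \<in> formal_functions B"
  by (induction I rule: infinite_finite_induct)
     (auto intro: formal_functions_add formal_functions_zero)

lemma formal_functions_partial:
  "f \<in> formal_functions B \<Longrightarrow> partial B a f \<in> formal_functions B"
  by (rule formal_functionsI,
      rule smooth_on_cong[OF open_B _ smooth_on_frechet_derivative[OF formal_functions_smooth]])
     (simp_all add: fps_nth_partial)

lemma formal_functions_fps_deriv:
  "f \<in> formal_functions B \<Longrightarrow> (\<lambda>t. fps_deriv (f t)) \<in> formal_functions B"
  by (auto simp: formal_functions_def simp del: of_nat_Suc intro!: smooth_on_mult open_B)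

lemma formal_functions_apply_vf:
  "Z \<in> vector_fields B \<Longrightarrow> f \<in> formal_functions B \<Longrightarrow> apply_vf B Z f \<in> formal_functions B"
  unfolding apply_vf_def[abs_def]
  by (intro formal_functions_add formal_functions_sum formal_functions_mult
      formal_functions_partial formal_functions_fps_deriv vector_fieldsD)

lemma partial_indicator: "partial B a (\<lambda>t. if t \<in> B then c else 0) = (\<lambda>_. 0)"
proof -
  have "frechet_derivative (\<lambda>x. fps_nth (if x \<in> B then c else 0) m) (at t) = (\<lambda>_. 0)"
    if "t \<in> B" for t m
    by (rule frechet_derivative_at[symmetric],
        rule has_derivative_transform_within_open[OF has_derivative_const open_B that]) auto
  then show ?thesis by (auto simp: partial_def fun_eq_iff fps_eq_iff)
qed

lemma partial_add:
  assumes "f \<in> formal_functions B" "g \<in> formal_functions B"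
  shows "partial B a (\<lambda>t. f t + g t) = (\<lambda>t. partial B a f t + partial B a g t)"
proof -
  have "frechet_derivative (\<lambda>x. fps_nth (f x + g x) m) (at t) =
     (\<lambda>v. frechet_derivative (\<lambda>x. fps_nth (f x) m) (at t) v
        + frechet_derivative (\<lambda>x. fps_nth (g x) m) (at t) v)" if "t \<in> B" for t m
    unfolding fps_add_nth using that
    by (intro frechet_derivative_at[symmetric] has_derivative_add
        formal_functions_has_derivative[OF assms(1)] formal_functions_has_derivative[OF assms(2)])
  then show ?thesis by (auto simp: partial_def fun_eq_iff fps_eq_iff)
qed

lemma partial_mult:
  assumes "f \<in> formal_functions B" "g \<in> formal_functions B"
  shows "partial B a (\<lambda>t. f t * g t) = (\<lambda>t. partial B a f t * g t + f t * partial B a g t)"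
proof -
  have "frechet_derivative (\<lambda>x. fps_nth (f x * g x) m) (at t) =
     (\<lambda>v. \<Sum>i=0..m. fps_nth (f t) i * frechet_derivative (\<lambda>x. fps_nth (g x) (m - i)) (at t) v
        + frechet_derivative (\<lambda>x. fps_nth (f x) i) (at t) v * fps_nth (g t) (m - i))"
    if "t \<in> B" for t m
    unfolding fps_mult_nth using that
    by (intro frechet_derivative_at[symmetric] has_derivative_sum has_derivative_mult
        formal_functions_has_derivative[OF assms(1)] formal_functions_has_derivative[OF assms(2)])
  then have "partial B a (\<lambda>t. f t * g t) t = partial B a f t * g t + f t * partial B a g t" for t
    by (cases "t \<in> B") (auto simp: fps_eq_iff fps_nth_partial fps_mult_nth sum.distrib)
  then show ?thesis by auto
qed

text \<open>Coefficientwise this is \<open>frechet_derivative_commute\<close>; what remains is to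
  replace \<open>partial B b f\<close>, which is defined by cases, by the plain derivative near
  \<open>t\<close>.\<close>

lemma partial_commute:
  assumes "f \<in> formal_functions B"
  shows "partial B a (partial B b f) = partial B b (partial B a f)"
proof -
  have "frechet_derivative (\<lambda>x. fps_nth (partial B b f x) m) (at t) =
      frechet_derivative (\<lambda>y. frechet_derivative (\<lambda>x. fps_nth (f x) m) (at y) (axis b 1)) (at t)"
    if "t \<in> B" for t m b
    by (rule frechet_derivative_transform_within_open[symmetric, OF _ open_B that])
       (auto simp: fps_nth_partial that
          intro!: smooth_on_differentiable smooth_on_frechet_derivative formal_functions_smooth assms)
  then have "partial B a (partial B b f) t = partial B b (partial B a f) t" for t
    using frechet_derivative_commute[OF open_B formal_functions_smooth[OF assms]]
    by (cases "t \<in> B") (auto simp: fps_eq_iff fps_nth_partial)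
  then show ?thesis by auto
qed

lemma partial_fps_deriv:
  assumes "f \<in> formal_functions B"
  shows "partial B a (\<lambda>t. fps_deriv (f t)) = (\<lambda>t. fps_deriv (partial B a f t))"
proof -
  have "frechet_derivative (\<lambda>x. fps_nth (fps_deriv (f x)) m) (at t) =
     (\<lambda>v. of_nat (m + 1) * frechet_derivative (\<lambda>x. fps_nth (f x) (m + 1)) (at t) v)"
    if "t \<in> B" for t m
    unfolding fps_deriv_nth using that
    by (intro frechet_derivative_at[symmetric] has_derivative_mult_right
        formal_functions_has_derivative[OF assms])
  then have "partial B a (\<lambda>t. fps_deriv (f t)) t = fps_deriv (partial B a f t)" for t
    by (cases "t \<in> B") (auto simp: fps_eq_iff fps_nth_partial)
  then show ?thesis by auto
qed

text \<open>The constant comes from the ground field, unlike in \<open>partial_indicator\<close>,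
  because the \<open>\<partial>\<^sub>u\<close> part of \<open>Z\<close> does not kill a general
  power series.\<close>

lemma apply_vf_indicator:
  "Z \<in> vector_fields B \<Longrightarrow> apply_vf B Z (\<lambda>t. if t \<in> B then fps_const c else 0) = (\<lambda>_. 0)"
  by (auto simp: apply_vf_def partial_indicator fun_eq_iff)

lemma apply_vf_add:
  assumes "f \<in> formal_functions B" "g \<in> formal_functions B"
  shows "apply_vf B Z (\<lambda>t. f t + g t) = (\<lambda>t. apply_vf B Z f t + apply_vf B Z g t)"
  by (auto simp: apply_vf_def partial_add[OF assms] fun_eq_iff algebra_simps sum.distrib)

lemma apply_vf_sum:
  assumes "\<And>i. i \<in> I \<Longrightarrow> f i \<in> formal_functions B"
  shows "apply_vf B Z (\<lambda>t. \<Sum>i\<in>I. f i t) = (\<lambda>t. \<Sum>i\<in>I. apply_vf B Z (f i) t)"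
proof -
  have zero: "apply_vf B Z (\<lambda>_. 0) = (\<lambda>_. 0)"
    by (simp add: apply_vf_def fun_eq_iff partial_indicator[where c = 0, simplified])
  show ?thesis
    using assms
    by (induction I rule: infinite_finite_induct)
       (auto simp: zero apply_vf_add formal_functions_sum)
qed

lemma apply_vf_mult:
  assumes "f \<in> formal_functions B" "g \<in> formal_functions B"
  shows "apply_vf B Z (\<lambda>t. f t * g t) = (\<lambda>t. apply_vf B Z f t * g t + f t * apply_vf B Z g t)"
  by (auto simp: apply_vf_def partial_mult[OF assms] fun_eq_iff algebra_simps sum.distrib
      sum_distrib_left)

lemma apply_vf_commutator:
  assumes Z: "Z \<in> vector_fields B" and W: "W \<in> vector_fields B" and f: "f \<in> formal_functions B"
  shows "apply_vf B Z (apply_vf B W f) t - apply_vf B W (apply_vf B Z f) t =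
    apply_vf B (lie_bracket B Z W) f t"
proof -
  \<comment> \<open>The part of \<open>Z (W f)\<close> in which both derivatives fall on
    \<open>f\<close>. The rest, where \<open>Z\<close> hits the components of \<open>W\<close>,
    supplies one half of the bracket.\<close>
  define second where "second Z W = (\<Sum>b\<in>UNIV. fst W t $ b * apply_vf B Z (partial B b f) t)
      + snd W t * apply_vf B Z (\<lambda>t. fps_deriv (f t)) t" for Z W
  have expand: "apply_vf B Z (apply_vf B W f) t =
      (\<Sum>b\<in>UNIV. apply_vf B Z (\<lambda>t. fst W t $ b) t * partial B b f t)
      + apply_vf B Z (snd W) t * fps_deriv (f t) + second Z W"
    if Z: "Z \<in> vector_fields B" and W: "W \<in> vector_fields B" for Z W
  proof -
    note W' = vector_fieldsD[OF W]
    have "apply_vf B W f = (\<lambda>t. (\<Sum>b\<in>UNIV. fst W t $ b * partial B b f t) + snd W t * fps_deriv (f t))"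
      by (auto simp: apply_vf_def)
    then have "apply_vf B Z (apply_vf B W f) t =
      (\<Sum>b\<in>UNIV. apply_vf B Z (\<lambda>t. fst W t $ b * partial B b f t) t)
      + apply_vf B Z (\<lambda>t. snd W t * fps_deriv (f t)) t"
      using W' f by (simp add: apply_vf_add apply_vf_sum formal_functions_sum formal_functions_mult
          formal_functions_partial formal_functions_fps_deriv)
    then show ?thesis
      using W' f by (simp add: apply_vf_mult formal_functions_partial formal_functions_fps_deriv
          second_def sum.distrib algebra_simps)
  qed
  have "second Z W = (\<Sum>b\<in>UNIV. \<Sum>a\<in>UNIV. fst W t $ b * fst Z t $ a * partial B a (partial B b f) t)
      + (\<Sum>b\<in>UNIV. fst W t $ b * snd Z t * fps_deriv (partial B b f t))
      + (\<Sum>a\<in>UNIV. fst Z t $ a * snd W t * fps_deriv (partial B a f t))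
      + snd Z t * snd W t * fps_deriv (fps_deriv (f t))" for Z W
    by (simp add: second_def apply_vf_def partial_fps_deriv[OF f] sum.distrib sum_distrib_left
        algebra_simps)
  \<comment> \<open>Exchanging \<open>Z\<close> and \<open>W\<close> transposes the double sum,
    which \<open>partial_commute\<close> compensates, swaps the two mixed sums, and fixes the last
    term.\<close>
  then have "second Z W = second W Z"
    using sum.swap[of "\<lambda>b a. fst W t $ b * fst Z t $ a * partial B a (partial B b f) t" UNIV UNIV]
    by (simp add: partial_commute[OF f] mult.commute[of "fst W t $ _"] mult.commute[of "snd W t"])
  moreover have "apply_vf B (lie_bracket B Z W) f t =
      (\<Sum>b\<in>UNIV. (apply_vf B Z (\<lambda>t. fst W t $ b) t - apply_vf B W (\<lambda>t. fst Z t $ b) t) * partial B b f t)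
      + (apply_vf B Z (snd W) t - apply_vf B W (snd Z) t) * fps_deriv (f t)"
    by (subst apply_vf_def) (simp add: lie_bracket_def)
  ultimately show ?thesis
    using expand[OF Z W] expand[OF W Z] by (simp add: algebra_simps sum_subtractf)
qed

lemma lie_bracket_in_vector_fields:
  assumes "Z \<in> vector_fields B" "W \<in> vector_fields B"
  shows "lie_bracket B Z W \<in> vector_fields B"
  using assms
  by (auto simp: lie_bracket_def vector_fields_def[of B] tangent_sections_def
      intro!: formal_functions_diff formal_functions_apply_vf)

end

text \<open>The normalisation depends on the domain: a formal function over \<open>B\<close> has to
  be cut off before it is one over \<open>U\<close>.\<close>

lemma formal_functions_restrict:
  assumes "open U" "U \<subseteq> B" "f \<in> formal_functions B"
  shows "(\<lambda>t. if t \<in> U then f t else 0) \<in> formal_functions U"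
proof (rule formal_functionsI)
  show "smooth_on U (\<lambda>t. fps_nth (if t \<in> U then f t else 0) m)" for m
    by (rule smooth_on_cong[OF assms(1) _ smooth_on_subset[OF formal_functions_smooth[OF assms(3)] assms(2)]])
       simp
qed simp

text \<open>Derivatives are local. Only agreement on \<open>U\<close> is asked of \<open>g\<close>,
  so functions with the wrong values off \<open>U\<close> can be treated too.\<close>

lemma partial_cong_on:
  assumes "open U" "U \<subseteq> B" "f \<in> formal_functions B" "\<And>x. x \<in> U \<Longrightarrow> f x = g x" "t \<in> U"
  shows "partial U a g t = partial B a f t"
proof -
  have "frechet_derivative (\<lambda>x. fps_nth (f x) m) (at t) = frechet_derivative (\<lambda>x. fps_nth (g x) m) (at t)"
    for m
    using assms by (intro frechet_derivative_transform_within_open[OF _ assms(1,5)]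
        smooth_on_differentiable[OF formal_functions_smooth[OF assms(3)]]) auto
  then show ?thesis using assms by (auto simp: partial_def)
qed

section \<open>Matrices\<close>

lemma matrix_inv_eqI:
  fixes A :: "'a::semiring_1^'n^'n"
  assumes "A ** C = mat 1" "C ** A = mat 1"
  shows "matrix_inv A = C"
proof -
  let ?I = "matrix_inv A"
  have "A ** ?I = mat 1 \<and> ?I ** A = mat 1"
    unfolding matrix_inv_def by (rule someI[of _ C]) (use assms in simp)
  then show ?thesis
    using assms by (metis matrix_mul_assoc matrix_mul_lid matrix_mul_rid)
qed

text \<open>\<open>transpose Q\<close> is a left inverse of \<open>transpose P\<close>, so
  \<open>transpose P\<close> sends nonzero vectors to nonzero vectors, and the form of
  \<open>A\<close> can be evaluated there.\<close>

lemma pos_def_congruence: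
  fixes A P Q :: "real^'n^'n"
  assumes "pos_def A" "P ** Q = mat 1"
  shows "pos_def (P ** A ** transpose P)"
  unfolding pos_def_def
proof (intro allI impI)
  fix v :: "real^'n" assume "v \<noteq> 0"
  have "transpose Q *v (transpose P *v v) = v"
    using assms(2) by (simp only: matrix_vector_mul_assoc transpose_mat matrix_vector_mul_lid
        flip: matrix_transpose_mul)
  then have "transpose P *v v \<noteq> 0"
    using \<open>v \<noteq> 0\<close> by (metis matrix_vector_mult_0_right)
  then have "(transpose P *v v) \<bullet> (A *v (transpose P *v v)) > 0"
    using assms(1) by (simp add: pos_def_def)
  then show "v \<bullet> (P ** A ** transpose P *v v) > 0"
    by (simp add: dot_lmul_matrix flip: matrix_vector_mul_assoc)
qed

lemma pos_def_right_inverse: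
  assumes "pos_def A"
  obtains C where "A ** C = mat 1"
proof -
  have "x = 0" if "A *v x = 0" for x
    using assms that by (metis inner_zero_right less_irrefl pos_def_def)
  then show ?thesis
    using that matrix_left_invertible_ker[of A] matrix_left_right_inverse[of _ A] by blast
qed

text \<open>
  Comparing coefficients of \<open>u\<^sup>n\<close> in \<open>(\<Sum>A\<^sub>k u\<^sup>k) (\<Sum>X\<^sub>k u\<^sup>k) = 1\<close>, with \<open>C\<close> the inverse of \<open>A\<^sub>0\<close>.
\<close>

fun right_inverse_coeff ::
  "(nat \<Rightarrow> 'a::comm_ring_1^'n^'n) \<Rightarrow> 'a^'n^'n \<Rightarrow> nat \<Rightarrow> 'a^'n^'n" where
  "right_inverse_coeff A C n =
     C ** ((if n = 0 then mat 1 else 0) - (\<Sum>k<n. A (n - k) ** right_inverse_coeff A C k))"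

declare right_inverse_coeff.simps [simp del]

lemma fps_matrix_right_inverse:
  fixes A :: "('a::comm_ring_1 fps)^'n^'n"
  assumes "(\<chi> i j. fps_nth (A $ i $ j) 0) ** C = mat 1"
  obtains X where "A ** X = mat 1"
proof
  define a where "a n = (\<chi> i j. fps_nth (A $ i $ j) n)" for n
  define x where "x = right_inverse_coeff a C"
  define X :: "('a fps)^'n^'n" where "X = (\<chi> i j. Abs_fps (\<lambda>n. x n $ i $ j))"
  have "(\<Sum>k\<le>n. a (n - k) ** x k) = (if n = 0 then mat 1 else 0)" for n
  proof -
    \<comment> \<open>The summand \<open>k = n\<close> of the convolution. With
      \<open>a 0 ** C = mat 1\<close> the recursion makes it exactly what the lower summands are
      short of.\<close>
    have "a 0 ** x n = (a 0 ** C) ** ((if n = 0 then mat 1 else 0) - (\<Sum>k<n. a (n - k) ** x k))"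
      unfolding x_def by (subst right_inverse_coeff.simps) (simp only: matrix_mul_assoc)
    also have "a 0 ** C = mat 1" using assms by (simp add: a_def)
    finally show ?thesis by (simp flip: lessThan_Suc_atMost)
  qed
  moreover have "fps_nth ((A ** X) $ i $ j) n = (\<Sum>k\<le>n. a (n - k) ** x k) $ i $ j" for i j n
  proof -
    have "fps_nth ((A ** X) $ i $ j) n =
        (\<Sum>l\<in>UNIV. \<Sum>k\<le>n. fps_nth (X $ l $ j) k * fps_nth (A $ i $ l) (n - k))"
      by (simp add: matrix_matrix_mult_def fps_sum_nth mult.commute[of "A $ i $ _"] fps_mult_nth atLeast0AtMost)
    also have "\<dots> = (\<Sum>k\<le>n. \<Sum>l\<in>UNIV. a (n - k) $ i $ l * x k $ l $ j)"
      by (subst sum.swap) (simp add: a_def X_def mult.commute)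
    finally show ?thesis by (simp add: matrix_matrix_mult_def)
  qed
  ultimately show "A ** X = mat 1"
    by (auto simp: vec_eq_iff fps_eq_iff mat_def)
qed

text \<open>Symmetry makes the one-sided inverse two-sided: transposing
  \<open>A ** X = mat 1\<close> yields a left inverse, the two coincide, and
  \<open>matrix_inv\<close> can only choose this one.\<close>

lemma symmetric_fps_matrix_inv:
  fixes A :: "('a::comm_ring_1 fps)^'n^'n"
  assumes "(\<chi> i j. fps_nth (A $ i $ j) 0) ** C = mat 1" "transpose A = A"
  shows "A ** matrix_inv A = mat 1"
proof -
  obtain X where X: "A ** X = mat 1" using fps_matrix_right_inverse[OF assms(1)] .
  have X': "transpose X ** A = mat 1"
    using X assms(2) by (metis matrix_transpose_mul transpose_mat)
  have "transpose X = X"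
    using X X' by (metis matrix_mul_assoc matrix_mul_lid matrix_mul_rid)
  then show ?thesis using X X' matrix_inv_eqI[of A X] by simp
qed

section \<open>Extension of scalars\<close>

lemma lift_scalars_nth [simp]: "fps_nth (lift_scalars f t) m = of_real (fps_nth (f t) m)"
  by (simp add: lift_scalars_def)

lemma frechet_derivative_of_real:
  assumes "f differentiable (at t)"
  shows "frechet_derivative (\<lambda>x. of_real (f x)) (at t) = (\<lambda>v. of_real (frechet_derivative f (at t) v))"
  by (rule frechet_derivative_at[symmetric], rule bounded_linear.has_derivative[OF bounded_linear_of_real])
     (use assms frechet_derivative_works in blast)

lemma formal_functions_lift_scalars:
  assumes "open B" "f \<in> formal_functions B"
  shows "lift_scalars f \<in> formal_functions B"
  by (rule formal_functionsI)
     (simp_all add: fps_eq_iff formal_functions_outside[OF assms(2)]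
       smooth_on_bounded_linear[OF assms(1) bounded_linear_of_real formal_functions_smooth[OF assms(2)]])

lemma partial_lift_scalars:
  assumes "f \<in> formal_functions B"
  shows "partial B a (lift_scalars f) = lift_scalars (partial B a f)"
proof -
  have "partial B a (lift_scalars f) t = lift_scalars (partial B a f) t" for t
  proof (cases "t \<in> B")
    case True
    then show ?thesis
      using smooth_on_differentiable[OF formal_functions_smooth[OF assms]]
      by (simp add: fps_eq_iff fps_nth_partial frechet_derivative_of_real)
  qed (simp add: fps_eq_iff)
  then show ?thesis by auto
qed

section \<open>The coordinate connection\<close>

lemma coord_frame_nth: "coord_frame B i t $ j = (if t \<in> B then if j = i then 1 else 0 else 0)"
  by (simp add: coord_frame_def axis_def)

lemma matrix_inv_coord_frame:
  "t \<in> B \<Longrightarrow> matrix_inv (\<chi> a j. coord_frame B j t $ a) = (mat 1 :: ('k::real_normed_field fps)^'n^'n)"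
  by (rule matrix_inv_eqI) (simp_all add: coord_frame_nth flip: mat_def)

lemma frame_coeff_coord_frame:
  assumes "X \<in> tangent_sections B"
  shows "frame_coeff (coord_frame B) X i = (\<lambda>t. X t $ i)"
proof -
  have "frame_coeff (coord_frame B) X i t = X t $ i" for t
    \<comment> \<open>Off \<open>B\<close> the frame matrix is zero and its
      \<open>matrix_inv\<close> unspecified, but it is applied to \<open>X t = 0\<close>.\<close>
    by (cases "t \<in> B")
       (simp_all add: frame_coeff_def matrix_inv_coord_frame tangent_sections_outside[OF assms])
  then show ?thesis by auto
qed

text \<open>The properties of the coordinate connection below are read off from this formula,
  component by component.\<close>

lemma frame_connection_coord_frame:
  assumes "Z \<in> vector_fields B" "X \<in> tangent_sections B"
  shows "frame_connection B (coord_frame B) Z X = (\<lambda>t. \<chi> i. apply_vf B Z (\<lambda>x. X x $ i) t)"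
proof -
  have "frame_connection B (coord_frame B) Z X t $ j = apply_vf B Z (\<lambda>x. X x $ j) t" for t j
    by (cases "t \<in> B")
       (simp_all add: frame_connection_def frame_coeff_coord_frame[OF assms(2)] coord_frame_nth
         apply_vf_outside[OF assms(1)] if_distrib[of "\<lambda>x. _ * x"] cong: if_cong)
  then show ?thesis by (simp add: fun_eq_iff vec_eq_iff)
qed

lemma along_in_vector_fields: "X \<in> tangent_sections B \<Longrightarrow> along X \<in> vector_fields B"
  by (simp add: along_def vector_fields_def formal_functions_zero)

lemma evaluation_commute: "evaluation \<alpha> X = evaluation X \<alpha>"
  by (simp add: evaluation_def fun_eq_iff mult.commute)

lemma evaluation_zero [simp]: "evaluation (\<lambda>_. 0) X = (\<lambda>_. 0)" "evaluation \<alpha> (\<lambda>_. 0) = (\<lambda>_. 0)"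
  by (simp_all add: evaluation_def fun_eq_iff)

lemma evaluation_coord_frame:
  "t \<in> B \<Longrightarrow> evaluation \<alpha> (coord_frame B i) t = \<alpha> t $ i"
  by (simp add: evaluation_def coord_frame_nth if_distrib[of "\<lambda>x. _ * x"] cong: if_cong)

context
  fixes B :: "(real^'n) set"
  assumes open_B: "open B"
begin

lemma coord_frame_tangent_sections:
  "(coord_frame B i :: ('n, 'k::real_normed_field) fsec) \<in> tangent_sections B"
proof -
  have "(\<lambda>t. (coord_frame B i :: ('n, 'k) fsec) t $ j) = (\<lambda>t. if t \<in> B then if j = i then 1 else 0 else 0)" for j
    by (simp add: coord_frame_nth)
  then show ?thesis by (simp add: tangent_sections_def formal_functions_indicator[OF open_B])
qed

lemma zero_tangent_sections: "(\<lambda>_. 0) \<in> tangent_sections B"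
  by (simp add: tangent_sections_def formal_functions_zero)

lemma scale_tangent_sections:
  "f \<in> formal_functions B \<Longrightarrow> X \<in> tangent_sections B \<Longrightarrow> (\<lambda>t. f t *s X t) \<in> tangent_sections B"
  by (simp add: tangent_sections_def formal_functions_mult[OF open_B])

lemma add_tangent_sections:
  "X \<in> tangent_sections B \<Longrightarrow> Y \<in> tangent_sections B \<Longrightarrow> (\<lambda>t. X t + Y t) \<in> tangent_sections B"
  by (simp add: tangent_sections_def formal_functions_add[OF open_B])

lemma frame_connection_tangent_sections:
  "Z \<in> vector_fields B \<Longrightarrow> X \<in> tangent_sections B \<Longrightarrow>
    frame_connection B (coord_frame B) Z X \<in> tangent_sections B"
  by (simp add: frame_connection_coord_frame)
     (simp add: tangent_sections_def formal_functions_apply_vf[OF open_B])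

lemma parallel_coord_frame:
  "parallel (vector_fields B) (frame_connection B (coord_frame B))
    (coord_frame B i :: ('n, 'k::real_normed_field) fsec)"
  unfolding parallel_def
proof
  fix Z :: "('n, 'k) fvec" assume Z: "Z \<in> vector_fields B"
  \<comment> \<open>The components are constant in \<open>t\<close> and also in \<open>u\<close>, as
    \<open>fps_const\<close> records; hence \<open>\<partial>\<^sub>u\<close> annihilates them
    too.\<close>
  have "(\<lambda>t. (coord_frame B i :: ('n, 'k) fsec) t $ j) =
      (\<lambda>t. if t \<in> B then fps_const (if j = i then 1 else 0) else 0)" for j
    by (auto simp: coord_frame_nth)
  then show "frame_connection B (coord_frame B) Z (coord_frame B i) = (\<lambda>_. 0)"
    by (simp only: frame_connection_coord_frame[OF Z coord_frame_tangent_sections]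
        apply_vf_indicator[OF open_B Z]) (simp add: fun_eq_iff vec_eq_iff)
qed

lemma is_connection_coord_frame:
  "is_connection B (vector_fields B) (tangent_sections B)
    (frame_connection B (coord_frame B) :: ('n, 'k::real_normed_field) fconn)"
  unfolding is_connection_def
proof (intro conjI ballI)
  let ?D = "frame_connection B (coord_frame B) :: ('n, 'k) fconn"
  fix Z W :: "('n, 'k) fvec" and X Y :: "('n, 'k) fsec" and f :: "('n, 'k) ffun"
  assume Z: "Z \<in> vector_fields B" and X: "X \<in> tangent_sections B"
  show "?D Z X \<in> tangent_sections B"
    by (rule frame_connection_tangent_sections[OF Z X])
  show "?D Z (\<lambda>t. X t + Y t) = (\<lambda>t. ?D Z X t + ?D Z Y t)" if Y: "Y \<in> tangent_sections B"
    using X Y by (simp add: frame_connection_coord_frame[OF Z] add_tangent_sections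
        apply_vf_add[OF open_B] tangent_sectionsD fun_eq_iff vec_eq_iff)
  assume f: "f \<in> formal_functions B"
  show "?D Z (\<lambda>t. f t *s X t) = (\<lambda>t. apply_vf B Z f t *s X t + f t *s ?D Z X t)"
    using X f by (simp add: frame_connection_coord_frame[OF Z] scale_tangent_sections
        apply_vf_mult[OF open_B] tangent_sectionsD fun_eq_iff vec_eq_iff)
  assume W: "W \<in> vector_fields B"
  have "(\<lambda>t. f t *s fst Z t + fst W t, \<lambda>t. f t * snd Z t + snd W t) \<in> vector_fields B"
    using Z W f by (auto simp: vector_fields_def
        intro!: scale_tangent_sections add_tangent_sections formal_functions_add formal_functions_mult open_B)
  then show "?D (\<lambda>t. f t *s fst Z t + fst W t, \<lambda>t. f t * snd Z t + snd W t) X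
      = (\<lambda>t. f t *s ?D Z X t + ?D W X t)"
    using Z W X by (simp add: frame_connection_coord_frame fun_eq_iff vec_eq_iff)
      (simp add: apply_vf_def algebra_simps sum.distrib sum_distrib_left)
qed

lemma flat_coord_frame:
  "flat B (vector_fields B) (tangent_sections B) (frame_connection B (coord_frame B))"
  unfolding flat_def
proof (intro ballI ext)
  fix Z W :: "('n, 'k::real_normed_field) fvec" and X :: "('n, 'k) fsec" and t
  assume *: "Z \<in> vector_fields B" "W \<in> vector_fields B" "X \<in> tangent_sections B"
  let ?D = "frame_connection B (coord_frame B)"
  show "?D Z (?D W X) t - ?D W (?D Z X) t = ?D (lie_bracket B Z W) X t"
    using * frame_connection_tangent_sections[OF *(1,3)] frame_connection_tangent_sections[OF *(2,3)]
    by (simp add: frame_connection_coord_frame lie_bracket_in_vector_fields[OF open_B] vec_eq_iff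
        apply_vf_commutator[OF open_B, symmetric] tangent_sectionsD)
qed

lemma torsion_free_coord_frame: "torsion_free B (frame_connection B (coord_frame B))"
  by (simp add: torsion_free_def frame_connection_coord_frame along_in_vector_fields fun_eq_iff vec_eq_iff
      lie_bracket_def) (simp add: along_def)

lemma formal_functions_evaluation:
  "\<alpha> \<in> tangent_sections B \<Longrightarrow> X \<in> tangent_sections B \<Longrightarrow> evaluation \<alpha> X \<in> formal_functions B"
  unfolding evaluation_def[abs_def]
  by (intro formal_functions_sum formal_functions_mult open_B tangent_sectionsD)

lemma apply_vf_evaluation:
  assumes "Z \<in> vector_fields B" "X \<in> tangent_sections B" "\<alpha> \<in> tangent_sections B"
  shows "apply_vf B Z (evaluation \<alpha> X) =
    (\<lambda>t. evaluation \<alpha> (frame_connection B (coord_frame B) Z X) t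
       + evaluation (frame_connection B (coord_frame B) Z \<alpha>) X t)"
proof -
  have "evaluation \<alpha> X = (\<lambda>t. \<Sum>i\<in>UNIV. \<alpha> t $ i * X t $ i)"
    by (auto simp: evaluation_def)
  then show ?thesis
    using assms
    by (simp add: apply_vf_sum[OF open_B] apply_vf_mult[OF open_B] formal_functions_mult[OF open_B]
        tangent_sectionsD frame_connection_coord_frame)
       (simp add: evaluation_def sum.distrib add.commute fun_eq_iff)
qed

section \<open>Non-degeneracy of the canonical pairing\<close>

lemma formal_linear_expansion:
  fixes \<phi> :: "('n, 'k::real_normed_field) fsec \<times> ('n, 'k) fsec \<Rightarrow> ('n, 'k) ffun"
  assumes \<phi>: "formal_linear B (tangent_sections B \<times> tangent_sections B) \<phi>"
    and s: "s \<in> tangent_sections B \<times> tangent_sections B"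
  shows "\<phi> s t = (\<Sum>i\<in>UNIV. fst s t $ i * \<phi> (coord_frame B i, \<lambda>_. 0) t)
    + (\<Sum>i\<in>UNIV. snd s t $ i * \<phi> (\<lambda>_. 0, coord_frame B i) t)"
proof -
  let ?H = "tangent_sections B \<times> tangent_sections B :: (('n, 'k) fsec \<times> ('n, 'k) fsec) set"
  define comb where "comb I e c = (\<lambda>t. \<Sum>i\<in>I. c i t *s fst (e i) t, \<lambda>t. \<Sum>i\<in>I. c i t *s snd (e i) t)"
    for I :: "'n set" and e :: "'n \<Rightarrow> ('n, 'k) fsec \<times> ('n, 'k) fsec" and c :: "'n \<Rightarrow> ('n, 'k) ffun"
  have scale: "fscale f s \<in> ?H" "\<phi> (fscale f s) = (\<lambda>t. f t * \<phi> s t)"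
    if "f \<in> formal_functions B" "s \<in> ?H" for f s
    using \<phi> that by (auto simp: formal_linear_def fscale_def scale_tangent_sections)
  have plus: "fplus s s' \<in> ?H" "\<phi> (fplus s s') = (\<lambda>t. \<phi> s t + \<phi> s' t)"
    if "s \<in> ?H" "s' \<in> ?H" for s s'
    using \<phi> that by (auto simp: formal_linear_def fplus_def add_tangent_sections)
  have comb: "comb I e c \<in> ?H \<and> \<phi> (comb I e c) = (\<lambda>t. \<Sum>i\<in>I. c i t * \<phi> (e i) t)"
    if "\<And>i. c i \<in> formal_functions B" "\<And>i. e i \<in> ?H" for I e c
  proof (induction I rule: infinite_finite_induct)
    case empty
    \<comment> \<open>\<open>formal_linear\<close> has no clause for zero; that the functional
      vanishes on the zero section follows from homogeneity with the factor 0.\<close>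
    have "fscale (\<lambda>_. 0) (\<lambda>_. 0, \<lambda>_. 0) = comb {} e c" by (simp add: fscale_def comb_def)
    then show ?case
      using scale[OF formal_functions_zero, of "(\<lambda>_. 0, \<lambda>_. 0)"] by (simp add: zero_tangent_sections)
  next
    case (insert i I)
    have "comb (insert i I) e c = fplus (fscale (c i) (e i)) (comb I e c)"
      using insert.hyps by (simp add: comb_def fplus_def fscale_def)
    then show ?case
      using insert plus[OF scale(1)[OF that(1) that(2), of i i], of "comb I e c"] scale(2)[OF that(1) that(2)]
      by simp
  qed simp
  define e1 where "e1 = (\<lambda>i. (coord_frame B i, \<lambda>_. 0) :: ('n, 'k) fsec \<times> ('n, 'k) fsec)"
  define e2 where "e2 = (\<lambda>i. (\<lambda>_. 0, coord_frame B i) :: ('n, 'k) fsec \<times> ('n, 'k) fsec)"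
  define c1 where "c1 i t = fst s t $ i" for i t
  define c2 where "c2 i t = snd s t $ i" for i t
  have expand: "(\<lambda>t. \<Sum>i\<in>UNIV. X t $ i *s coord_frame B i t) = X" if "X \<in> tangent_sections B"
    for X :: "('n, 'k) fsec"
  proof -
    have "(\<Sum>i\<in>UNIV. X t $ i *s coord_frame B i t) = X t" for t
      by (cases "t \<in> B")
         (simp_all add: vec_eq_iff coord_frame_nth tangent_sections_outside[OF that]
           if_distrib[of "\<lambda>x. _ * x"] cong: if_cong)
    then show ?thesis by auto
  qed
  have "comb UNIV e1 c1 = (fst s, \<lambda>_. 0)" "comb UNIV e2 c2 = (\<lambda>_. 0, snd s)"
    using expand[of "fst s"] expand[of "snd s"] s
    by (auto simp: comb_def e1_def e2_def c1_def c2_def)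
  then have s_eq: "s = fplus (comb UNIV e1 c1) (comb UNIV e2 c2)" by (simp add: fplus_def)
  have c: "c1 i \<in> formal_functions B" "c2 i \<in> formal_functions B" for i
    using s by (auto simp: c1_def[abs_def] c2_def[abs_def] tangent_sections_def)
  have e: "e1 i \<in> ?H" "e2 i \<in> ?H" for i
    by (auto simp: e1_def e2_def coord_frame_tangent_sections zero_tangent_sections)
  note C1 = comb[of c1 e1 UNIV, OF c(1) e(1)] and C2 = comb[of c2 e2 UNIV, OF c(2) e(2)]
  have "\<phi> s t = (\<Sum>i\<in>UNIV. c1 i t * \<phi> (e1 i) t) + (\<Sum>i\<in>UNIV. c2 i t * \<phi> (e2 i) t)"
    unfolding s_eq plus(2)[OF conjunct1[OF C1] conjunct1[OF C2]] conjunct2[OF C1] conjunct2[OF C2] ..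
  then show ?thesis by (simp add: c1_def c2_def e1_def e2_def)
qed

text \<open>A linear functional is determined by its values on the frame and the coframe; these
  values are formal functions and serve as the components of the representing section.\<close>

lemma nondegenerate_canonical_pairing:
  "nondegenerate_symmetric_form B (tangent_sections B \<times> tangent_sections B)
    (canonical_pairing :: ('n, 'k::real_normed_field) fsec \<times> ('n, 'k) fsec \<Rightarrow> _)"
  unfolding nondegenerate_symmetric_form_def
proof (intro conjI ballI allI impI)
  let ?H = "tangent_sections B \<times> tangent_sections B :: (('n, 'k) fsec \<times> ('n, 'k) fsec) set"
  fix s :: "('n, 'k) fsec \<times> ('n, 'k) fsec" assume s: "s \<in> ?H"
  show "formal_linear B ?H (canonical_pairing s)"
    unfolding formal_linear_def
  proof (intro conjI ballI)
    show "canonical_pairing s s' \<in> formal_functions B" if "s' \<in> ?H" for s'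
      using s that unfolding canonical_pairing_def[abs_def]
      by (intro formal_functions_add[OF open_B] formal_functions_evaluation) auto
    show "canonical_pairing s (fscale f s') = (\<lambda>t. f t * canonical_pairing s s' t)" for f s'
      by (simp add: canonical_pairing_def fscale_def evaluation_def fun_eq_iff sum_distrib_left
          distrib_left mult.left_commute mult.assoc)
    show "canonical_pairing s (fplus s' s'') = (\<lambda>t. canonical_pairing s s' t + canonical_pairing s s'' t)"
      for s' s''
      by (simp add: canonical_pairing_def fplus_def evaluation_def fun_eq_iff algebra_simps sum.distrib)
  qed
  show "canonical_pairing s s' = canonical_pairing s' s" for s'
    by (simp add: canonical_pairing_def fun_eq_iff add.commute)
next
  let ?H = "tangent_sections B \<times> tangent_sections B :: (('n, 'k) fsec \<times> ('n, 'k) fsec) set"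
  fix \<phi> :: "('n, 'k) fsec \<times> ('n, 'k) fsec \<Rightarrow> ('n, 'k) ffun"
  assume \<phi>: "formal_linear B ?H \<phi>"
  let ?e = "\<lambda>i. (coord_frame B i, \<lambda>_. 0) :: ('n, 'k) fsec \<times> ('n, 'k) fsec"
  let ?f = "\<lambda>i. (\<lambda>_. 0, coord_frame B i) :: ('n, 'k) fsec \<times> ('n, 'k) fsec"
  have basis: "?e i \<in> ?H" "?f i \<in> ?H" for i
    by (auto simp: coord_frame_tangent_sections zero_tangent_sections)
  \<comment> \<open>The components are crossed: tangent components of \<open>s\<close> are detected
    by the coframe, cotangent ones by the frame.\<close>
  define s where "s = (\<lambda>t. \<chi> i. \<phi> (?f i) t, \<lambda>t. \<chi> i. \<phi> (?e i) t)"
  have sH: "s \<in> ?H"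
    using \<phi> basis by (auto simp: s_def tangent_sections_def formal_linear_def)
  show "\<exists>!s. s \<in> ?H \<and> (\<forall>s'\<in>?H. canonical_pairing s s' = \<phi> s')"
  proof (rule ex1I[of _ s])
    have "canonical_pairing s s' = \<phi> s'" if "s' \<in> ?H" for s'
      by (rule ext)
         (simp add: formal_linear_expansion[OF \<phi> that] canonical_pairing_def evaluation_def s_def mult.commute)
    then show "s \<in> ?H \<and> (\<forall>s'\<in>?H. canonical_pairing s s' = \<phi> s')" using sH by blast
  next
    fix s' assume s': "s' \<in> ?H \<and> (\<forall>r\<in>?H. canonical_pairing s' r = \<phi> r)"
    have "fst s' t $ i = fst s t $ i \<and> snd s' t $ i = snd s t $ i" for t i
    proof (cases "t \<in> B")
      case True
      have "canonical_pairing s' (?f i) t = \<phi> (?f i) t" "canonical_pairing s' (?e i) t = \<phi> (?e i) t"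
        using s' basis by simp_all
      then show ?thesis
        using True by (simp add: canonical_pairing_def evaluation_coord_frame s_def
            evaluation_commute[of "coord_frame B i"])
    next
      case False
      then show ?thesis
        using s' sH by (auto simp: mem_Times_iff tangent_sections_outside)
    qed
    then show "s' = s" by (simp add: prod_eq_iff fun_eq_iff vec_eq_iff)
  qed
qed

end

text \<open>Every condition involving vector fields is universal in them, so the axioms for fixed
  \<open>u\<close> follow from those over all of \<open>B \<times> D\<close>.\<close>

lemma legendre_axioms_mono:
  assumes "legendre_axioms B \<Z> L" "\<Z>' \<subseteq> \<Z>"
  shows "legendre_axioms B \<Z>' L"
proof -
  have "is_connection B \<Z>' S \<D>" if "is_connection B \<Z> S \<D>" for S \<D>
    using that assms(2) unfolding is_connection_def by (meson subsetD)
  moreover have "flat B \<Z>' S \<D>" if "flat B \<Z> S \<D>" for S \<D>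
    using that assms(2) unfolding flat_def by (meson subsetD)
  ultimately show ?thesis
    using assms unfolding legendre_axioms_def by (meson subsetD)
qed

lemma apply_vf_coord_frame:
  "t \<in> B \<Longrightarrow> apply_vf B (along (coord_frame B a)) f t = partial B a f t"
  by (simp add: apply_vf_def along_def coord_frame_nth if_distrib[of "\<lambda>x. x * _"] cong: if_cong)

section \<open>The dual coframe and convexity in flat coordinates\<close>

context
  fixes B :: "(real^'n) set"
  assumes open_B: "open B"
begin

lemma dual_coframe_eq_coord_frame:
  fixes F :: "('n, real) ffun"
  assumes F: "F \<in> formal_functions B" and pos: "\<And>t. t \<in> B \<Longrightarrow> formal_pos_def (hessian B F t)"
  shows "dual_coframe B (lift_scalars F) = (coord_frame B :: 'n \<Rightarrow> ('n, 'k::real_normed_field) fsec)"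
proof (intro ext)
  fix i and t :: "real^'n"
  define G :: "('n, 'k) ffun" where "G = lift_scalars F"
  define H where "H = hessian B G t"
  have G: "G \<in> formal_functions B"
    using formal_functions_lift_scalars[OF open_B F] by (simp add: G_def)
  have sym: "transpose H = H"
    by (simp add: H_def hessian_def transpose_def vec_eq_iff partial_commute[OF open_B G])
  show "dual_coframe B (lift_scalars F) i t = (coord_frame B i t :: ('k fps)^'n)"
  proof (cases "t \<in> B")
    case True
    \<comment> \<open>Positivity is known for the real Hessian, so its constant term is inverted
      over the reals; \<open>of_real\<close> is a ring homomorphism and carries the inverse to
      \<open>k\<close>.\<close>
    let ?H0 = "\<chi> i j. fps_nth (hessian B F t $ i $ j) 0"
    obtain C where C: "?H0 ** C = mat 1"
      using pos[OF True] pos_def_right_inverse by (auto simp: formal_pos_def_def)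
    let ?C = "(\<chi> i j. of_real (C $ i $ j)) :: 'k^'n^'n"
    have "((\<chi> i j. fps_nth (H $ i $ j) 0) ** ?C) $ i $ j = of_real ((?H0 ** C) $ i $ j)" for i j
      by (simp add: matrix_matrix_mult_def H_def hessian_def G_def partial_lift_scalars F
          formal_functions_partial[OF open_B])
    then have "(\<chi> i j. fps_nth (H $ i $ j) 0) ** ?C = mat 1"
      by (simp add: C vec_eq_iff mat_def)
    then have inv: "H ** matrix_inv H = mat 1"
      using symmetric_fps_matrix_inv sym by blast
    \<comment> \<open>Jacobian and Hessian list the two derivatives in opposite orders.\<close>
    have "(\<chi> j a. partial B a (dual_coord B G j) t) = H"
      by (simp add: H_def hessian_def dual_coord_def vec_eq_iff partial_commute[OF open_B G])
    then have "dual_coframe B G i t = column i (matrix_inv H) v* H"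
      using True by (simp add: dual_coframe_def dual_frame_def H_def)
    also have "\<dots> = H *v column i (matrix_inv H)"
      using sym by (metis transpose_matrix_vector)
    also have "\<dots> = column i (H ** matrix_inv H)"
      by (simp add: vec_eq_iff column_def matrix_matrix_mult_def matrix_vector_mult_def)
    finally show ?thesis
      using True by (simp add: inv G_def coord_frame_def column_def mat_def axis_def vec_eq_iff)
  next
    case False
    then show ?thesis
      by (simp add: dual_coframe_def dual_frame_def coord_frame_def)
  qed
qed

lemma christoffel_coord_frame:
  "frame_connection B (coord_frame B) (along (coord_frame B a)) (coord_frame B b) = (\<lambda>_. 0)"
  using parallel_coord_frame[OF open_B, unfolded parallel_def]
    along_in_vector_fields[OF coord_frame_tangent_sections[OF open_B]] by blast

text \<open>Supplies the flat charts whose existence \<open>formally_strictly_convex_wrt\<close>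
  requires: one chart, given by the affine coordinates, covers \<open>B\<close>.\<close>

lemma flat_coordinates_coord_frame:
  "flat_coordinates B (frame_connection B (coord_frame B) :: ('n, 'k::real_normed_field) fconn) B
    (\<lambda>i t. if t \<in> B then fps_const (t $ i) else 0) (coord_frame B)"
proof -
  let ?\<theta> = "\<lambda>i t. if t \<in> B then fps_const (t $ i) else 0 :: real fps"
  have theta: "?\<theta> i \<in> formal_functions B" for i
  proof (rule formal_functionsI)
    have "smooth_on B (\<lambda>t. if m = 0 then t $ i else 0)" for m
      by (cases "m = 0") (simp_all add: smooth_on_bounded_linear[OF open_B bounded_linear_vec_nth smooth_on_ident[OF open_B]])
    then show "smooth_on B (\<lambda>t. fps_nth (?\<theta> i t) m)" for m
      by (rule smooth_on_cong[OF open_B, rotated]) simp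
  qed simp
  have dtheta: "partial B a (?\<theta> j) t = (if a = j then 1 else 0)" if "t \<in> B" for a j t
  proof -
    have "frechet_derivative (\<lambda>x. fps_nth (?\<theta> j x) m) (at t) = (\<lambda>v. if m = 0 then v $ j else 0)" for m
    proof (rule frechet_derivative_at[symmetric])
      have "((\<lambda>x. if m = 0 then x $ j else 0) has_derivative (\<lambda>v. if m = 0 then v $ j else 0)) (at t)"
        by (cases m) (auto intro: bounded_linear_imp_has_derivative bounded_linear_vec_nth)
      then show "((\<lambda>x. fps_nth (?\<theta> j x) m) has_derivative (\<lambda>v. if m = 0 then v $ j else 0)) (at t)"
        by (rule has_derivative_transform_within_open[OF _ open_B that]) simp
    qed
    then show ?thesis
      using that by (auto simp: fps_eq_iff fps_nth_partial axis_def)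
  qed
  have "inj_on (\<lambda>t. \<chi> i. fps_nth (?\<theta> i t) 0) B"
    by (auto simp: inj_on_def vec_eq_iff)
  moreover have "apply_vf B (along (coord_frame B i)) (?\<theta> j) t = (if i = j then 1 else 0)"
    if "t \<in> B" for i j t
    using that by (simp only: apply_vf_coord_frame dtheta)
  ultimately have "local_coordinates B ?\<theta> (coord_frame B)"
    using theta by (simp add: local_coordinates_def open_B coord_frame_tangent_sections[OF open_B])
  moreover have "partial B a (lift_scalars (\<lambda>x. coord_frame B i x $ c)) t = (0 :: 'k fps)" for a i c t
  proof -
    have "lift_scalars (\<lambda>x. coord_frame B i x $ c) =
        (\<lambda>t. if t \<in> B then (if c = i then 1 else 0) else (0 :: 'k fps))"
      by (auto simp: fun_eq_iff fps_eq_iff coord_frame_nth)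
    then show ?thesis by (simp add: partial_indicator[OF open_B])
  qed
  ultimately show ?thesis by (simp add: flat_coordinates_def christoffel_coord_frame)
qed

text \<open>
  The components of flat coordinate fields are locally constant, so the Hessian in flat coordinates
  is congruent to the Hessian in the coordinates of \<open>B\<close>.
\<close>

lemma formal_pos_def_hessian_in:
  fixes F :: "('n, real) ffun"
  assumes flat: "flat_coordinates B (frame_connection B (coord_frame B) :: ('n, 'k::real_normed_field) fconn) U \<theta> X"
    and F: "F \<in> formal_functions B" and t: "t \<in> U" and pos: "formal_pos_def (hessian B F t)"
  shows "formal_pos_def (hessian_in U X F t)"
proof -
  have U: "U \<subseteq> B" "open U" and X: "\<And>i. X i \<in> tangent_sections U"
    and dual: "\<And>i j. apply_vf U (along (X i)) (\<theta> j) t = (if i = j then 1 else 0)"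
    using flat t by (auto simp: flat_coordinates_def local_coordinates_def)
  have "partial U a (lift_scalars (\<lambda>x. X i x $ c)) t = (0 :: 'k fps)" for i a c
    using flat t by (auto simp: flat_coordinates_def christoffel_coord_frame)
  \<comment> \<open>The Christoffel symbols vanish, so being parallel means constant components over
    \<open>k\<close>; injectivity of \<open>of_real\<close> brings this back to the reals.\<close>
  then have const: "partial U a (\<lambda>x. X i x $ c) t = 0" for i a c
    by (simp add: partial_lift_scalars[OF tangent_sectionsD[OF X]] fps_eq_iff)
  define G where "G = (\<lambda>t. if t \<in> U then F t else 0)"
  have G: "G \<in> formal_functions U"
    unfolding G_def by (rule formal_functions_restrict[OF U(2,1) F])
  have d1: "partial U b F = partial U b G" for b
  proof
    show "partial U b F x = partial U b G x" for x
      using partial_cong_on[OF U(2) order_refl G, of F x b] by (cases "x \<in> U") (auto simp: G_def)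
  qed
  have d2: "partial U a (partial U b F) t = partial B a (partial B b F) t" for a b
    by (rule partial_cong_on[OF U(2,1) formal_functions_partial[OF open_B F] _ t])
       (rule partial_cong_on[OF U(2,1) F, symmetric], auto)
  have pF: "partial U b F \<in> formal_functions U" for b
    by (simp add: d1 formal_functions_partial[OF U(2) G])
  have "hessian_in U X F t $ i $ j =
      (\<Sum>a\<in>UNIV. X i t $ a * (\<Sum>b\<in>UNIV. X j t $ b * partial B a (partial B b F) t))" for i j
  proof -
    have "apply_vf U (along (X j)) F = (\<lambda>t. \<Sum>b\<in>UNIV. X j t $ b * partial U b F t)"
      by (auto simp: apply_vf_def along_def)
    moreover have "partial U a (\<lambda>t. \<Sum>b\<in>UNIV. X j t $ b * partial U b F t) t =
        (\<Sum>b\<in>UNIV. X j t $ b * partial B a (partial B b F) t)" for a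
    proof -
      \<comment> \<open>The sum rule is available for \<open>apply_vf\<close>; taking the coordinate
        field for the vector field gives it for \<open>partial\<close>.\<close>
      have "(\<lambda>t. X j t $ b * partial U b F t) \<in> formal_functions U" for b
        by (intro formal_functions_mult[OF U(2)] tangent_sectionsD[OF X] pF)
      then have "apply_vf U (along (coord_frame U a)) (\<lambda>t. \<Sum>b\<in>UNIV. X j t $ b * partial U b F t) =
          (\<lambda>t. \<Sum>b\<in>UNIV. apply_vf U (along (coord_frame U a)) (\<lambda>t. X j t $ b * partial U b F t) t)"
        by (intro apply_vf_sum[OF U(2)])
      then
      have "partial U a (\<lambda>t. \<Sum>b\<in>UNIV. X j t $ b * partial U b F t) t =
          (\<Sum>b\<in>UNIV. partial U a (\<lambda>t. X j t $ b * partial U b F t) t)"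
        by (simp flip: apply_vf_coord_frame[OF t])
      then show ?thesis
        by (simp add: partial_mult[OF U(2) tangent_sectionsD[OF X] pF] const d2)
    qed
    ultimately show ?thesis
      by (simp add: hessian_in_def along_def apply_vf_def[of U "(X i, \<lambda>_. 0)"])
  qed
  \<comment> \<open>Formal positivity sees only constant terms, and these multiply like the series;
    row \<open>i\<close> of \<open>P\<close> is the constant term of the field
    \<open>X i\<close>.\<close>
  moreover define P where "P = (\<chi> i a. fps_nth (X i t $ a) 0)"
  moreover define A where "A = (\<chi> i j. fps_nth (hessian B F t $ i $ j) 0)"
  ultimately have "(\<chi> i j. fps_nth (hessian_in U X F t $ i $ j) 0) = P ** (A ** transpose P)"
    by (simp add: vec_eq_iff matrix_matrix_mult_def transpose_def hessian_def fps_sum_nth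
        mult.commute[of "fps_nth (partial B _ _ _) 0"])
  then have "(\<chi> i j. fps_nth (hessian_in U X F t $ i $ j) 0) = P ** A ** transpose P"
    by (simp only: matrix_mul_assoc)
  \<comment> \<open>Constant terms of the duality between the fields \<open>X i\<close> and the
    coordinates \<open>\<theta> j\<close>: the Jacobian of \<open>\<theta>\<close> is the
    \<open>Q\<close> that \<open>pos_def_congruence\<close> asks for.\<close>
  moreover have "P ** (\<chi> a j. fps_nth (partial U a (\<theta> j) t) 0) = mat 1"
  proof -
    have "(\<Sum>a\<in>UNIV. X i t $ a * partial U a (\<theta> j) t) = (if i = j then 1 else 0)" for i j
      using dual[of i j] by (simp add: apply_vf_def along_def)
    from arg_cong[OF this, of "\<lambda>f. fps_nth f 0"] show ?thesis
      by (simp add: P_def matrix_matrix_mult_def mat_def vec_eq_iff fps_sum_nth)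
  qed
  moreover have "pos_def A"
    using pos by (simp add: formal_pos_def_def A_def)
  ultimately show ?thesis
    by (simp only: formal_pos_def_def pos_def_congruence)
qed

end

theorem theorem1:
  fixes T :: "(real^'n) set" and F :: "real^'n \<Rightarrow> real fps"
  assumes "hessian_qft T F"
  shows "let L :: ('n, 'k::real_normed_field) legendre_data =
           \<lparr> Hplus = tangent_sections T,
             Hminus = cotangent_sections T,
             pairing = canonical_pairing,
             nabla_plus = frame_connection T (coord_frame T),
             nabla_minus = frame_connection T (dual_coframe T (lift_scalars F)),
             potential = F \<rparr>
         in legendre_family T L \<and>
            (\<forall>i. parallel (vector_fields T) (nabla_plus L) (coord_frame T i)) \<and>
            (\<forall>i. parallel (vector_fields T) (nabla_minus L) (dual_coframe T (lift_scalars F) i))"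
proof -
  have T: "open T" and F: "F \<in> formal_functions T"
    and pos: "\<And>t. t \<in> T \<Longrightarrow> formal_pos_def (hessian T F t)"
    using assms by (auto simp: hessian_qft_def)
  define D where "D = (frame_connection T (coord_frame T) :: ('n, 'k) fconn)"
  \<comment> \<open>Both connections are entered as \<open>D\<close>;
    \<open>dual_coframe_eq_coord_frame\<close> reconciles this with the stated
    \<open>nabla_minus\<close> in the last step.\<close>
  define L :: "('n, 'k) legendre_data" where
    "L = \<lparr> Hplus = tangent_sections T, Hminus = cotangent_sections T, pairing = canonical_pairing,
           nabla_plus = D, nabla_minus = D, potential = F \<rparr>"
  have axioms: "legendre_axioms T (vector_fields T) L"
    unfolding legendre_axioms_def L_def cotangent_sections_eq D_def
    by (simp add: nondegenerate_canonical_pairing[OF T] is_connection_coord_frame[OF T] flat_coord_frame[OF T])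
       (simp add: canonical_pairing_def[abs_def] apply_vf_evaluation[OF T])
  have "formally_strictly_convex_wrt T D F"
    unfolding formally_strictly_convex_wrt_def
  proof (intro conjI ballI allI impI)
    show "\<exists>U \<theta> X. p \<in> U \<and> flat_coordinates T D U \<theta> X" if "p \<in> T" for p
      unfolding D_def using flat_coordinates_coord_frame[OF T] that by blast
    show "formal_pos_def (hessian_in U X F t)" if "flat_coordinates T D U \<theta> X" "t \<in> U" for U \<theta> X t
      using that formal_pos_def_hessian_in[OF T that(1)[unfolded D_def] F that(2)] pos
      by (auto simp: flat_coordinates_def)
  qed
  then have "classical_legendre_fixed_u T L"
    using legendre_axioms_mono[OF axioms fixed_u_fields_subset] F
    by (simp add: classical_legendre_fixed_u_def L_def D_def torsion_free_coord_frame[OF T])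
  then have "legendre_family T L"
    using T axioms by (simp add: legendre_family_def)
  then show ?thesis
    using parallel_coord_frame[OF T, where 'k = 'k] dual_coframe_eq_coord_frame[OF T F pos, where 'k = 'k]
    by (simp add: L_def D_def)
qed

end
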